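(* Let $a>0$, $x>0$, $0<\theta,\psi<1$, let $k\geq 1$ be an odd integer, and let $\nu\in\mathbb{C}$ with $\Re(\nu)>0$. Then \begin{align*} &\left(\frac{a^2x}{4}\right)^{\frac{\nu}{2}+k+1}\sum_{n=1}^{\infty} n^{\nu/2}K_{\nu}(a\sqrt{nx})\sum_{d\mid n}d^k\cos(2\pi d\theta)\cos\left(\frac{2\pi n\psi}{d}\right)\\ &=\frac{(-1)^{\frac{k-1}{2}}a^{2k+2}k!}{2^{2k+4}(2\pi)^{k+1}}\Gamma(\nu)\bigl\{\zeta(k+1,\theta)+\zeta(k+1,1-\theta)\bigr\}x^{k+1}\\ &\quad+\frac{(-1)^{\frac{k+1}{2}}}{8}(2\pi)^{k+1}\Gamma(\nu+k+1)\sum_{n,m\geq 0}\left\{\frac{(n+\psi)^k}{\left(\frac{16\pi^2}{a^2}\frac{(m+\theta)(n+\psi)}{x}+1\right)^{\nu+k+1}}+\frac{(n+1-\psi)^k}{\left(\frac{16\pi^2}{a^2}\frac{(m+\theta)(n+1-\psi)}{x}+1\right)^{\nu+k+1}}\right.\\ &\qquad\left.+\frac{(n+\psi)^k}{\left(\frac{16\pi^2}{a^2}\frac{(m+1-\theta)(n+\psi)}{x}+1\right)^{\nu+k+1}}+\frac{(n+1-\psi)^k}{\left(\frac{16\pi^2}{a^2}\frac{(m+1-\theta)(n+1-\psi)}{x}+1\right)^{\nu+k+1}}\right\}. \end{align*}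
   Context: $K_\nu$ denotes the modified Bessel function of the second kind of order $\nu$. $\zeta(s,\alpha)=\sum_{n=0}^\infty (n+\alpha)^{-s}$ ($\Re s>1$) is the Hurwitz zeta function. The double sum runs over all pairs of non-negative integers $m,n$. *)

theory Defs
  imports "HOL-Analysis.Analysis"
begin

definition besselK :: "complex \<Rightarrow> real \<Rightarrow> complex" where
  "besselK nu z = integral {0..} (\<lambda>t::real. complex_of_real (exp (- z * cosh t)) * cosh (nu * complex_of_real t))"

definition hurwitz_zeta :: "real \<Rightarrow> real \<Rightarrow> real" where
  "hurwitz_zeta s \<alpha> = (\<Sum>n. (real n + \<alpha>) powr (- s))"

end

theory Submission
  imports Defs
begin

text \<open>The integral representation of \<open>K\<^sub>\<nu>\<close> turns the left-hand side into a Mellin-type transform of the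
  Lambert series \<open>S(y) = \<Sum> \<sigma>(n) e\<^bsup>-ny\<^esup>\<close>, where \<open>\<sigma>(n)\<close> is the twisted divisor sum. Two applications of
  the Lipschitz formula \<open>\<Sum>\<^sub>n (n + \<psi>)\<^sup>k e\<^bsup>-l(n + \<psi>)\<^esup> = k! \<Sum>\<^sub>e e\<^bsup>2\<pi>ie\<psi>\<^esup> / (l + 2\<pi>ie)\<^bsup>k+1\<^esup>\<close>, one in each
  summation variable, express \<open>S(y)\<close> as a constant, which comes from the row \<open>e = 0\<close> and produces the
  Hurwitz zeta values, plus a dual Lambert series in \<open>1 / y\<close>. Termwise integration then gives the
  \<open>\<Gamma>(\<nu>)\<close> term and the double sum. For \<open>k = 1\<close> the lattice sum between the two applications converges
  only conditionally; multiplying it by \<open>1 - e\<^bsup>2\<pi>i\<psi>\<^esup>\<close>, which is nonzero, makes the interchange of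
  summations legitimate.\<close>

section \<open>Fourier series with absolutely summable coefficients\<close>

text \<open>Since k is odd, the lattice exponent k + 1 is even. Rows e and -e are therefore complex
  conjugates and together give twice a real part. Columns whose imaginary part has the wrong sign
  reduce to the others by e -> -e, which sends \<psi> to 1 - \<psi>. A second source of 1 - \<psi>
  is the product of cosines in the divisor sum: cos A cos B is the mean of cos (A + B) and cos (A -
  B), so two Lambert series are averaged. Together the two effects pair each of \<theta>, 1 -
  \<theta> with each of \<psi>, 1 - \<psi>, hence four families. All integrals are taken over the
  real line in the logarithmic variable t, where scaling becomes translation. There the factor
  y^(-(k+1)) of the dual series turns into exp ((k+1) t) and moves the Gamma parameter from \<nu> to
  s = \<nu> + k + 1. The condition Re \<nu> > 0 then says Re s - k > 1, which is the absolute
  convergence of the final double sum in n.\<close>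

inductive trig_poly :: "(real \<Rightarrow> complex) \<Rightarrow> bool" where
  monomial: "trig_poly (\<lambda>t. c * cis (2 * pi * of_int n * t))"
| add: "trig_poly f \<Longrightarrow> trig_poly g \<Longrightarrow> trig_poly (\<lambda>t. f t + g t)"

lemma trig_poly_mult:
  assumes "trig_poly f" "trig_poly g"
  shows "trig_poly (\<lambda>t. f t * g t)"
  using assms
proof (induction f rule: trig_poly.induct)
  case (monomial c n)
  from \<open>trig_poly g\<close> show ?case
  proof (induction g rule: trig_poly.induct)
    case (monomial d m)
    have "(\<lambda>t. c * cis (2 * pi * of_int n * t) * (d * cis (2 * pi * of_int m * t)))
        = (\<lambda>t. (c * d) * cis (2 * pi * of_int (n + m) * t))"
      by (simp add: fun_eq_iff cis_mult ring_distribs)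
    then show ?case using trig_poly.monomial[of "c * d" "n + m"] by simp
  next
    case (add f g)
    then show ?case by (auto simp: distrib_left intro: trig_poly.add)
  qed
next
  case (add f g)
  then show ?case by (auto simp: distrib_right intro: trig_poly.add)
qed

text \<open>The Stone-Weierstrass theorem delivers real polynomials in the coordinates of the plane.
  On the unit circle a linear functional p is cos x p(1) + sin x p(i), a combination of cis x and
  cis (-x); closure under products does the rest.\<close>

lemma trig_poly_real_polynomial_function:
  fixes p :: "complex \<Rightarrow> real"
  assumes "real_polynomial_function p"
  shows "trig_poly (\<lambda>t. complex_of_real (p (cis (2 * pi * t))))"
  using assms
proof (induction p rule: real_polynomial_function.induct)
  case (linear p)
  define \<alpha> where "\<alpha> = complex_of_real (p 1)"
  define \<beta> where "\<beta> = complex_of_real (p \<i>)"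
  have "complex_of_real (p (cis x)) = ((\<alpha> - \<i> * \<beta>) / 2) * cis x + ((\<alpha> + \<i> * \<beta>) / 2) * cis (- x)" for x
  proof -
    have "cis x = cos x *\<^sub>R 1 + sin x *\<^sub>R \<i>"
      by (simp add: complex_eq_iff)
    then have "p (cis x) = cos x * p 1 + sin x * p \<i>"
      using linear_add[OF bounded_linear.linear[OF linear]] linear_cmul[OF bounded_linear.linear[OF linear]]
      by (simp del: scaleR_conv_of_real)
    then show ?thesis
      by (simp add: \<alpha>_def \<beta>_def complex_eq_iff field_simps)
  qed
  then have "(\<lambda>t. complex_of_real (p (cis (2 * pi * t)))) =
     (\<lambda>t. ((\<alpha> - \<i> * \<beta>) / 2) * cis (2 * pi * of_int 1 * t) + ((\<alpha> + \<i> * \<beta>) / 2) * cis (2 * pi * of_int (-1) * t))"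
    by simp
  then show ?case
    by (simp only:) (intro trig_poly.add trig_poly.monomial)
next
  case (const c)
  then show ?case using trig_poly.monomial[of "of_real c" 0] by simp
next
  case (add f g)
  then show ?case by (auto intro: trig_poly.add)
next
  case (mult f g)
  then show ?case by (auto intro: trig_poly_mult)
qed

lemma trig_poly_approx:
  fixes u :: "real \<Rightarrow> real"
  assumes u: "continuous_on {0..1} u" "u 0 = u 1" and e: "0 < e"
  obtains p where "trig_poly (\<lambda>t. complex_of_real (p t))" "\<And>t. t \<in> {0..1} \<Longrightarrow> \<bar>u t - p t\<bar> < e"
proof -
  \<comment> \<open>The angle jumps at the point 1 of the circle, and u composed with it is
    continuous there only because u 0 = u 1. Passing the trivial homotopy from u to itself through
    the correspondence between loops and circle maps yields this continuity.\<close>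
  have "homotopic_loops UNIV u u"
    using u by (subst homotopic_loops_refl) (simp add: path_def pathstart_def pathfinish_def path_image_def)
  then have "homotopic_with_canon (\<lambda>h. True) (sphere 0 1) UNIV (u \<circ> (\<lambda>z. Arg2pi z / (2 * pi))) (u \<circ> (\<lambda>z. Arg2pi z / (2 * pi)))"
    by (rule homotopic_loops_imp_homotopic_circlemaps)
  then have c: "continuous_on (sphere 0 1) (u \<circ> (\<lambda>z. Arg2pi z / (2 * pi)))"
    using homotopic_with_imp_continuous by blast
  obtain g where g: "real_polynomial_function g"
    "\<And>z. z \<in> sphere 0 1 \<Longrightarrow> \<bar>(u \<circ> (\<lambda>z. Arg2pi z / (2 * pi))) z - g z\<bar> < e"
    using Stone_Weierstrass_real_polynomial_function[OF compact_sphere c e] by blast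
  have "\<bar>u t - g (cis (2 * pi * t))\<bar> < e" if t: "t \<in> {0..1}" for t
  \<comment> \<open>The angle of the point 1 is 0, so at t = 1 the circle map returns u 0.\<close>
  proof (cases "t = 1")
    case True
    have "Arg2pi 1 = 0" using Arg2pi_of_real[of 1] by simp
    with g(2)[of 1] True u show ?thesis by simp
  next
    case False
    then have "Arg2pi (cis (2 * pi * t)) = 2 * pi * t"
      using t by (intro Arg2pi_unique[of 1]) (auto simp: cis_conv_exp)
    then show ?thesis using g(2)[of "cis (2 * pi * t)"] by simp
  qed
  with that[of "\<lambda>t. g (cis (2 * pi * t))"] trig_poly_real_polynomial_function[OF g(1)] show ?thesis
    by simp
qed

lemma trig_poly_continuous: "trig_poly f \<Longrightarrow> continuous_on S f"
proof (induction f rule: trig_poly.induct)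
  case (monomial c n)
  show ?case unfolding cis_conv_exp by (intro continuous_intros)
next
  case (add f g)
  then show ?case by (intro continuous_on_add)
qed

lemma integral_trig_poly_eq_0:
  fixes f :: "real \<Rightarrow> complex"
  assumes f: "continuous_on {0..1} f"
    and coeff: "\<And>n::int. integral {0..1} (\<lambda>t. f t * cis (2 * pi * of_int n * t)) = 0"
    and g: "trig_poly g"
  shows "integral {0..1} (\<lambda>t. f t * g t) = 0"
  using g
proof (induction g rule: trig_poly.induct)
  case (monomial c n)
  have "integral {0..1} (\<lambda>t. c * (f t * cis (2 * pi * of_int n * t))) = 0"
    using coeff[of n] by simp
  then show ?case by (simp add: mult_ac)
next
  case (add g h)
  have "(\<lambda>t. f t * g t) integrable_on {0..1}" "(\<lambda>t. f t * h t) integrable_on {0..1}"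
    by (intro integrable_continuous_real continuous_on_mult f trig_poly_continuous add.hyps)+
  then show ?case using add.IH by (simp add: distrib_left integral_add)
qed

text \<open>For a real trigonometric polynomial p within e of u, orthogonality turns the integral of
  u^2 into that of u (u - p), which is at most e times the integral of |u|. Letting e tend to 0 and
  using continuity forces u = 0.\<close>

lemma real_Fourier_unique:
  fixes u :: "real \<Rightarrow> real"
  assumes u: "continuous_on {0..1} u" "u 0 = u 1"
    and orth: "\<And>p. trig_poly (\<lambda>t. complex_of_real (p t)) \<Longrightarrow> integral {0..1} (\<lambda>t. u t * p t) = 0"
    and t: "t \<in> {0..1}"
  shows "u t = 0"
proof -
  define M where "M = integral {0..1} (\<lambda>t. \<bar>u t\<bar>)"
  have i2: "(\<lambda>t. u t * u t) integrable_on {0..1}" and ia: "(\<lambda>t. \<bar>u t\<bar>) integrable_on {0..1}"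
    by (intro integrable_continuous_real continuous_intros u)+
  have M: "M \<ge> 0" unfolding M_def by (rule integral_nonneg[OF ia]) simp
  have small: "integral {0..1} (\<lambda>t. u t * u t) \<le> e * M" if e: "e > 0" for e
  proof -
    obtain p where p: "trig_poly (\<lambda>t. complex_of_real (p t))" "\<And>t. t \<in> {0..1} \<Longrightarrow> \<bar>u t - p t\<bar> < e"
      using trig_poly_approx[OF u e] by blast
    have "continuous_on {0..1} (\<lambda>t. Re (complex_of_real (p t)))"
      using trig_poly_continuous[OF p(1)] by (intro continuous_intros) auto
    then have pc: "continuous_on {0..1} p" by simp
    have ip: "(\<lambda>t. u t * p t) integrable_on {0..1}"
      by (intro integrable_continuous_real continuous_intros u pc)
    have "integral {0..1} (\<lambda>t. u t * u t) = integral {0..1} (\<lambda>t. u t * u t) - integral {0..1} (\<lambda>t. u t * p t)"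
      using orth[OF p(1)] by simp
    also have "\<dots> = integral {0..1} (\<lambda>t. u t * u t - u t * p t)"
      by (simp add: integral_diff[OF i2 ip])
    also have "\<dots> \<le> integral {0..1} (\<lambda>t. e * \<bar>u t\<bar>)"
    proof (rule integral_le)
      show "u t * u t - u t * p t \<le> e * \<bar>u t\<bar>" if "t \<in> {0..1}" for t
      proof -
        have "u t * u t - u t * p t = u t * (u t - p t)" by (simp add: algebra_simps)
        also have "\<dots> \<le> \<bar>u t\<bar> * \<bar>u t - p t\<bar>" by (metis abs_ge_self abs_mult)
        also have "\<dots> \<le> \<bar>u t\<bar> * e" using p(2)[OF that] by (intro mult_left_mono) auto
        finally show ?thesis by (simp add: mult.commute)
      qed
    qed (auto intro!: integrable_diff i2 ip integrable_on_mult_right ia)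
    also have "\<dots> = e * M" by (simp add: M_def)
    finally show ?thesis .
  qed
  have "integral {0..1} (\<lambda>t. u t * u t) \<le> 0"
  proof (rule field_le_epsilon)
    fix e :: real assume "e > 0"
    then have "integral {0..1} (\<lambda>t. u t * u t) \<le> e / (M + 1) * M" using M by (intro small) auto
    also have "\<dots> \<le> e" using M \<open>e > 0\<close> by (simp add: field_simps)
    finally show "integral {0..1} (\<lambda>t. u t * u t) \<le> 0 + e" by simp
  qed
  moreover have "integral {0..1} (\<lambda>t. u t * u t) \<ge> 0" by (rule integral_nonneg[OF i2]) auto
  ultimately have "integral {0..1} (\<lambda>t. u t * u t) = 0" by simp
  then have "((\<lambda>t. u t * u t) has_integral 0) {0..1}" using i2 by (simp add: has_integral_iff)
  then have "u t * u t = 0"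
    using has_integral_0_cbox_imp_0[of 0 1 "\<lambda>t. u t * u t" t] t continuous_on_mult[OF u(1) u(1)]
    by simp
  then show ?thesis by simp
qed

lemma Fourier_unique:
  fixes f :: "real \<Rightarrow> complex"
  assumes f: "continuous_on {0..1} f" "f 0 = f 1"
    and coeff: "\<And>n::int. integral {0..1} (\<lambda>t. f t * cis (2 * pi * of_int n * t)) = 0"
    and t: "t \<in> {0..1}"
  shows "f t = 0"
proof -
  \<comment> \<open>Because p is real, real and imaginary parts pass through the product, and the
    complex claim splits into two real ones.\<close>
  have orth: "integral {0..1} (\<lambda>t. Re (f t) * p t) = 0 \<and> integral {0..1} (\<lambda>t. Im (f t) * p t) = 0"
    if p: "trig_poly (\<lambda>t. complex_of_real (p t))" for p
  proof -
    have "(\<lambda>t. f t * complex_of_real (p t)) integrable_on {0..1}"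
      by (intro integrable_continuous_real continuous_on_mult f trig_poly_continuous[OF p])
    then have "((\<lambda>t. f t * complex_of_real (p t)) has_integral 0) {0..1}"
      using integral_trig_poly_eq_0[OF f(1) coeff p] by (simp add: has_integral_iff)
    from has_integral_Re[OF this] has_integral_Im[OF this] show ?thesis
      by (simp add: has_integral_iff)
  qed
  have "Re (f t) = 0"
    by (rule real_Fourier_unique[OF continuous_on_Re[OF f(1)] _ _ t]) (use f(2) orth in auto)
  moreover have "Im (f t) = 0"
    by (rule real_Fourier_unique[OF continuous_on_Im[OF f(1)] _ _ t]) (use f(2) orth in auto)
  ultimately show ?thesis by (simp add: complex_eq_iff)
qed

text \<open>Uniform convergence along the filter of finite subsets serves unordered sums over any
  index type, so one M-test gives both continuity of the limit and termwise integration.\<close>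

lemma has_sum_integral_m_test:
  fixes f :: "'i \<Rightarrow> real \<Rightarrow> complex"
  assumes cont: "\<And>i. continuous_on {a..b} (f i)"
    and le: "\<And>i t. i \<in> I \<Longrightarrow> t \<in> {a..b} \<Longrightarrow> norm (f i t) \<le> M i"
    and M: "M summable_on I"
    and c: "\<And>i. (f i has_integral c i) {a..b}"
    and g: "\<And>t. t \<in> {a..b} \<Longrightarrow> ((\<lambda>i. f i t) has_sum g t) I"
  shows "continuous_on {a..b} g" and "(c has_sum integral {a..b} g) I"
proof -
  have u: "uniform_limit {a..b} (\<lambda>F t. \<Sum>i\<in>F. f i t) g (finite_subsets_at_top I)"
    by (rule Weierstrass_m_test_general'[OF le g M])
  have cf: "continuous_on {a..b} (\<lambda>t. \<Sum>i\<in>F. f i t)" for F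
    by (intro continuous_on_sum cont)
  show "continuous_on {a..b} g"
    by (rule uniform_limit_theorem[OF _ u]) (use cf in auto)
  obtain I' J where J: "\<And>F. ((\<lambda>t. \<Sum>i\<in>F. f i t) has_integral I' F) {a..b}" "(g has_integral J) {a..b}"
    "(I' \<longlongrightarrow> J) (finite_subsets_at_top I)"
    by (rule uniform_limit_integral[OF u cf]) auto
  have "(sum c \<longlongrightarrow> J) (finite_subsets_at_top I)"
  proof (rule Lim_transform_eventually[OF J(3)])
    have "I' F = sum c F" if "finite F" for F
      by (rule has_integral_unique[OF J(1)]) (intro has_integral_sum c that)
    then show "\<forall>\<^sub>F F in finite_subsets_at_top I. I' F = sum c F"
      by (intro eventually_finite_subsets_at_top_weakI) auto
  qed
  with J(2) show "(c has_sum integral {a..b} g) I"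
    by (simp add: has_sum_def integral_unique)
qed

section \<open>Fourier inversion on the unit interval\<close>

lemma has_integral_cis_unit_interval:
  "((\<lambda>t. cis (2 * pi * of_int n * t)) has_integral (if n = 0 then 1 else 0)) {0..1}"
proof (cases "n = 0")
  case True
  then show ?thesis using has_integral_const_real[of "1::complex" 0 1] by simp
next
  case False
  define c where "c = 2 * pi * of_int n * \<i>"
  have c: "c \<noteq> 0" using False by (simp add: c_def)
  have eq: "cis (2 * pi * of_int n * t) = exp (c * of_real t)" for t
    by (simp add: c_def cis_conv_exp mult_ac)
  have "((\<lambda>t. exp (c * of_real t)) has_integral (exp (c * of_real 1) / c - exp (c * of_real 0) / c)) {0..1}"
  proof (rule fundamental_theorem_of_calculus)
    fix t :: real
    have "((\<lambda>z. exp (c * z) / c) has_field_derivative exp (c * of_real t)) (at (of_real t))"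
      using c by (auto intro!: derivative_eq_intros)
    then show "((\<lambda>t. exp (c * of_real t) / c) has_vector_derivative exp (c * of_real t)) (at t within {0..1})"
      by (rule has_vector_derivative_at_within[OF has_vector_derivative_real_field])
  qed simp
  moreover have "exp c = 1"
    using eq[of 1] cis_multiple_2pi[of "of_int n"] by (simp add: mult_ac)
  ultimately show ?thesis using False by (simp add: eq)
qed

text \<open>Absolute summability makes the series converge to a continuous g whose coefficients are
  found termwise. They agree with those of f, and uniqueness applies to f - g.\<close>

theorem Fourier_series_has_sum:
  fixes f :: "real \<Rightarrow> complex"
  assumes f: "continuous_on {0..1} f" "f 0 = f 1"
    and c: "\<And>n::int. ((\<lambda>t. f t * cis (- (2 * pi * of_int n * t))) has_integral c n) {0..1}"
    and summ: "(\<lambda>n. norm (c n)) summable_on UNIV"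
    and t: "t \<in> {0..1}"
  shows "((\<lambda>n. c n * cis (2 * pi * of_int n * t)) has_sum f t) UNIV"
proof -
  define g where "g t = (\<Sum>\<^sub>\<infinity>n. c n * cis (2 * pi * of_int n * t))" for t :: real
  have g: "((\<lambda>n. c n * cis (2 * pi * of_int n * t)) has_sum g t) UNIV" for t
    unfolding g_def
    by (rule has_sum_infsum[OF abs_summable_summable]) (use summ in \<open>simp add: norm_mult\<close>)
  have cont_cis: "continuous_on A (\<lambda>t. cis (2 * pi * of_int n * t))" for A and n :: int
    unfolding cis_conv_exp by (intro continuous_intros)
  have gc: "continuous_on {0..1} g"
  proof (rule has_sum_integral_m_test(1))
    show "((\<lambda>t. c n * cis (2 * pi * of_int n * t)) has_integral c n * (if n = 0 then 1 else 0)) {0..1}" for n :: int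
      by (intro has_integral_mult_right has_integral_cis_unit_interval)
  qed (use summ g cont_cis in \<open>auto intro!: continuous_on_mult simp: norm_mult\<close>)
  \<comment> \<open>The test function carries the sign +m, so it isolates the term n = -m.\<close>
  have coeff: "integral {0..1} (\<lambda>t. g t * cis (2 * pi * of_int m * t)) = c (- m)" for m :: int
  proof -
    have "((\<lambda>n. c n * (if n + m = 0 then 1 else 0)) has_sum integral {0..1} (\<lambda>t. g t * cis (2 * pi * of_int m * t))) UNIV"
    proof (rule has_sum_integral_m_test(2))
      have "(\<lambda>t. c n * cis (2 * pi * of_int n * t) * cis (2 * pi * of_int m * t))
        = (\<lambda>t. c n * cis (2 * pi * of_int (n + m) * t))" for n :: int
        by (simp add: fun_eq_iff cis_mult ring_distribs)
      then show "((\<lambda>t. c n * cis (2 * pi * of_int n * t) * cis (2 * pi * of_int m * t))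
          has_integral c n * (if n + m = 0 then 1 else 0)) {0..1}" for n :: int
        using has_integral_mult_right[OF has_integral_cis_unit_interval] by metis
      show "((\<lambda>n. c n * cis (2 * pi * of_int n * t) * cis (2 * pi * of_int m * t)) has_sum
         g t * cis (2 * pi * of_int m * t)) UNIV" for t
        by (intro has_sum_cmult_left g)
    qed (use summ cont_cis in \<open>auto intro!: continuous_on_mult simp: norm_mult\<close>)
    moreover have "((\<lambda>n. c n * (if n + m = 0 then 1 else 0)) has_sum c (- m)) UNIV"
      by (rule has_sum_finite_neutralI[of "{- m}"]) auto
    ultimately show ?thesis using has_sum_unique by blast
  qed
  have "f t - g t = 0"
  proof (rule Fourier_unique[OF _ _ _ t])
    show "continuous_on {0..1} (\<lambda>t. f t - g t)" by (intro continuous_on_diff f gc)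
    have "cis (2 * pi * of_int n) = 1" for n :: int
      using cis_multiple_2pi[of "of_int n"] by simp
    then have "g 0 = g 1" by (simp add: g_def)
    then show "f 0 - g 0 = f 1 - g 1" using f by simp
    fix m :: int
    have "integral {0..1} (\<lambda>t. f t * cis (2 * pi * of_int m * t)) = c (- m)"
      using c[of "- m"] by (simp add: integral_unique)
    moreover have "(\<lambda>t. f t * cis (2 * pi * of_int m * t)) integrable_on {0..1}"
      "(\<lambda>t. g t * cis (2 * pi * of_int m * t)) integrable_on {0..1}"
      by (intro integrable_continuous_real continuous_on_mult f gc cont_cis)+
    ultimately show "integral {0..1} (\<lambda>t. (f t - g t) * cis (2 * pi * of_int m * t)) = 0"
      using coeff[of m] by (simp add: left_diff_distrib integral_diff)
  qed
  with g show ?thesis by simp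
qed

section \<open>The Lipschitz summation formula\<close>

text \<open>One term of the exponential series is at most the whole. The exponent m is free, so it
  can be chosen to beat a given polynomial growth and leave 1 / n^2 over.\<close>

lemma exp_minus_le_fact_div_power:
  fixes v :: real
  assumes "v > 0"
  shows "exp (- v) \<le> fact m / v ^ m"
proof -
  have "(\<Sum>n\<in>{m}. v ^ n /\<^sub>R fact n) \<le> (\<Sum>n. v ^ n /\<^sub>R fact n)"
    using assms summable_exp_generic[of v] by (intro sum_le_suminf) auto
  then have "v ^ m / fact m \<le> exp v"
    by (simp add: exp_def field_simps)
  then show ?thesis
    using assms by (simp add: exp_minus field_simps)
qed

section \<open>Summability of powers and of polynomials times exponentials\<close>

lemma summable_on_nat_powr:
  fixes s :: real
  assumes "s > 1"
  shows "(\<lambda>n. (1 + real n) powr (- s)) summable_on UNIV"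
proof -
  have "summable (\<lambda>n. real (Suc n) powr (- s))"
    using assms by (subst summable_Suc_iff) (simp add: summable_real_powr_iff)
  then show ?thesis
    by (intro summable_nonneg_imp_summable_on) (auto simp: add.commute)
qed

lemma summable_on_int_powr:
  fixes s :: real
  assumes "s > 1"
  shows "(\<lambda>n::int. (1 + \<bar>of_int n\<bar>) powr (- s)) summable_on UNIV"
proof -
  have "(\<lambda>n::int. (1 + \<bar>of_int n\<bar>) powr (- s)) summable_on range int"
    using summable_on_nat_powr[OF assms] by (subst summable_on_reindex) (simp_all add: o_def)
  moreover have "(\<lambda>n::int. (1 + \<bar>of_int n\<bar>) powr (- s)) summable_on range (\<lambda>n. - int n)"
    using summable_on_nat_powr[OF assms] by (subst summable_on_reindex) (simp_all add: o_def inj_on_def)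
  moreover have "range int \<union> range (\<lambda>n. - int n) = UNIV"
  proof -
    have "n \<in> range int \<union> range (\<lambda>n. - int n)" for n
      by (cases n rule: int_cases2) auto
    then show ?thesis by blast
  qed
  ultimately show ?thesis
    using summable_on_union by fastforce
qed

lemma linear_bound_vertical_line:
  fixes l :: complex
  assumes "Re l > 0"
  obtains K where "K > 0" "\<And>n::int. 1 + \<bar>of_int n\<bar> \<le> K * norm (l + 2 * pi * \<i> * of_int n)"
proof
  \<comment> \<open>With z = l + 2 pi i n, the first summand comes from 1 <= |z| / Re l, and the
    bracket from |n| <= |z - l| <= |z| + |l| after bounding |l| by |l| |z| / Re l.\<close>
  define K where "K = 1 / Re l + (1 + norm l / Re l)"
  show "K > 0" using assms by (simp add: K_def add_pos_nonneg)
  fix n :: int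
  define z where "z = l + 2 * pi * \<i> * of_int n"
  have r: "Re l \<le> norm z" using complex_Re_le_cmod[of z] by (simp add: z_def)
  then have 1: "1 \<le> norm z / Re l" using assms by simp
  have "\<bar>of_int n\<bar> \<le> 2 * pi * \<bar>of_int n\<bar>"
    using pi_gt3 by (intro mult_le_cancel_right1[THEN iffD2]) auto
  also have "\<dots> = norm (z - l)" by (simp add: z_def norm_mult)
  also have "\<dots> \<le> norm z + norm l * 1" using norm_triangle_ineq4[of z l] by simp
  also have "\<dots> \<le> norm z + norm l * (norm z / Re l)"
    using 1 by (intro add_left_mono mult_left_mono) auto
  finally have "\<bar>real_of_int n\<bar> \<le> norm z + norm l * (norm z / Re l)" by simp
  with 1 show "1 + \<bar>real_of_int n\<bar> \<le> K * norm (l + 2 * pi * \<i> * of_int n)"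
    unfolding z_def[symmetric] K_def by (simp add: algebra_simps)
qed

lemma summable_on_inverse_power_vertical_line:
  fixes l :: complex
  assumes "Re l > 0" "p \<ge> 2"
  shows "(\<lambda>n::int. norm (c / (l + 2 * pi * \<i> * of_int n) ^ p)) summable_on UNIV"
proof -
  obtain K where K: "K > 0" "\<And>n::int. 1 + \<bar>of_int n\<bar> \<le> K * norm (l + 2 * pi * \<i> * of_int n)"
    using linear_bound_vertical_line[OF assms(1)] by blast
  have s: "(\<lambda>n::int. norm c * K ^ p * (1 + \<bar>of_int n\<bar>) powr (- 2)) summable_on UNIV"
    by (intro summable_on_cmult_right summable_on_int_powr) auto
  show ?thesis
  proof (rule summable_on_comparison_test[OF s])
    fix n :: int
    define z where "z = l + 2 * pi * \<i> * of_int n"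
    have K': "1 + \<bar>of_int n\<bar> \<le> K * norm z" using K by (simp add: z_def)
    then have z: "norm z > 0" using K(1) by (smt (verit) mult_nonneg_nonpos)
    have "(1 + \<bar>real_of_int n\<bar>) ^ 2 \<le> (1 + \<bar>of_int n\<bar>) ^ p"
      using assms by (intro power_increasing) auto
    also have "\<dots> \<le> (K * norm z) ^ p" using K' by (intro power_mono) auto
    finally have "1 / norm z ^ p \<le> K ^ p / (1 + \<bar>of_int n\<bar>) ^ 2"
      using z by (simp add: field_simps power_mult_distrib)
    then have "norm c * (1 / norm z ^ p) \<le> norm c * (K ^ p / (1 + \<bar>of_int n\<bar>) ^ 2)"
      by (intro mult_left_mono) auto
    then show "norm (c / (l + 2 * pi * \<i> * of_int n) ^ p) \<le> norm c * K ^ p * (1 + \<bar>of_int n\<bar>) powr (- 2)"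
      unfolding z_def[symmetric] by (simp add: norm_divide norm_power powr_minus powr_numeral field_simps)
  qed auto
qed

lemma summable_polynomial_exp:
  fixes r :: real
  assumes "r > 0"
  shows "summable (\<lambda>n. (real n + 1) ^ k * exp (- r * real n))"
proof (rule summable_comparison_test')
  show "summable (\<lambda>n. exp r * fact (k + 2) / r ^ (k + 2) * (1 / (real (Suc n)) ^ 2))"
    by (intro summable_mult) (subst summable_Suc_iff, rule inverse_power_summable[of 2, unfolded inverse_eq_divide], simp)
  fix n :: nat
  define v where "v = r * (real n + 1)"
  have v: "v > 0" using assms by (simp add: v_def)
  have "(real n + 1) ^ k * exp (- r * real n) = exp r * ((real n + 1) ^ k * exp (- v))"
    by (simp add: v_def algebra_simps flip: exp_add)
  \<comment> \<open>The exponent k + 2 cancels the polynomial factor and leaves an inverse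
    square.\<close>
  also have "\<dots> \<le> exp r * ((real n + 1) ^ k * (fact (k + 2) / v ^ (k + 2)))"
    by (intro mult_left_mono exp_minus_le_fact_div_power v) auto
  also have "\<dots> = exp r * fact (k + 2) / r ^ (k + 2) * (1 / (real (Suc n)) ^ 2)"
  proof -
    define X where "X = real n + 1"
    have X: "X > 0" "real (Suc n) = X" by (simp_all add: X_def)
    have "v ^ (k + 2) = r ^ (k + 2) * (X ^ k * X ^ 2)"
      unfolding v_def X_def[symmetric] by (simp add: power_mult_distrib power_add power2_eq_square)
    then show ?thesis
      using assms X(1) unfolding X(2) X_def[symmetric] by simp
  qed
  finally show "norm ((real n + 1) ^ k * exp (- r * real n)) \<le> exp r * fact (k + 2) / r ^ (k + 2) * (1 / (real (Suc n)) ^ 2)"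
    by simp
qed

text \<open>The bound is independent of t in the unit interval, which is the form of majorant that
  the M-test asks for.\<close>

lemma norm_shifted_term_le:
  fixes \<mu> :: complex
  assumes "Re \<mu> > 0" "0 \<le> t" "t \<le> 1"
  shows "norm (of_real ((real n + t) ^ k) * exp (- \<mu> * of_real (real n + t))) \<le> (real n + 1) ^ k * exp (- Re \<mu> * real n)"
proof -
  have "\<bar>(real n + t) ^ k\<bar> \<le> (real n + 1) ^ k"
    using assms by (simp add: power_abs[symmetric] power_mono)
  moreover have "exp (- (Re \<mu> * (real n + t))) \<le> exp (- Re \<mu> * real n)"
    using assms by (simp add: distrib_left)
  ultimately show ?thesis
    unfolding norm_mult norm_exp_eq_Re norm_of_real by (intro mult_mono) auto
qed

text \<open>A(t) is the tail integral of u^k exp (-\<mu> u) over u >= t. Its value at 0 is the Gamma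
  integral for k + 1, and integrals over [n, n + 1] become differences that telescope.\<close>

lemma exp_power_antiderivative:
  fixes \<mu> :: complex
  assumes "Re \<mu> > 0"
  obtains A :: "real \<Rightarrow> complex" where "A 0 = fact k / \<mu> ^ (k + 1)"
    "\<And>t. (A has_vector_derivative - (of_real (t ^ k) * exp (- \<mu> * of_real t))) (at t)"
    "(\<lambda>n. A (real n)) \<longlonglongrightarrow> 0"
proof (induction k arbitrary: thesis)
  have \<mu>: "\<mu> \<noteq> 0" using assms by auto
  have der: "((\<lambda>t. of_real (t ^ j) * exp (- \<mu> * of_real t) / \<mu>) has_vector_derivative
      (of_nat j * of_real (t ^ (j - 1)) * exp (- \<mu> * of_real t) / \<mu> - of_real (t ^ j) * exp (- \<mu> * of_real t))) (at t)" for j t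
  proof -
    have "((\<lambda>z. z ^ j * exp (- \<mu> * z) / \<mu>) has_field_derivative
      (of_nat j * of_real t ^ (j - 1) * exp (- \<mu> * of_real t) / \<mu> - of_real t ^ j * exp (- \<mu> * of_real t))) (at (of_real t))"
      using \<mu> by (auto intro!: derivative_eq_intros simp: field_simps)
    from has_vector_derivative_real_field[OF this] show ?thesis by simp
  qed
  have lim: "(\<lambda>n. of_real (real n ^ j) * exp (- \<mu> * of_real (real n)) / \<mu>) \<longlonglongrightarrow> 0" for j
  proof -
    have "summable (\<lambda>n. of_real ((real n + 0) ^ j) * exp (- \<mu> * of_real (real n + 0)))"
      by (rule summable_comparison_test'[OF summable_polynomial_exp[OF assms], where N = 0]) (rule norm_shifted_term_le, use assms in auto)
    from tendsto_divide[OF summable_LIMSEQ_zero[OF this] tendsto_const \<mu>] show ?thesis by simp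
  qed
  {
    case 0
    show ?case
      by (rule 0[of "\<lambda>t. of_real (t ^ 0) * exp (- \<mu> * of_real t) / \<mu>"]) (use der[of 0] lim[of 0] in auto)
  next
    case (Suc k)
    obtain A where A: "A 0 = fact k / \<mu> ^ (k + 1)"
    "\<And>t. (A has_vector_derivative - (of_real (t ^ k) * exp (- \<mu> * of_real t))) (at t)"
    "(\<lambda>n. A (real n)) \<longlonglongrightarrow> 0" using Suc.IH by blast
    \<comment> \<open>Integration by parts of the tail integral: a boundary term plus (k + 1) /
      \<mu> times the tail for k.\<close>
    let ?B = "\<lambda>t. of_real (t ^ Suc k) * exp (- \<mu> * of_real t) / \<mu> + of_nat (Suc k) / \<mu> * A t"
    show ?case
    proof (rule Suc.prems[of ?B])
      show "?B 0 = fact (Suc k) / \<mu> ^ (Suc k + 1)" using A(1) by simp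
      show "(\<lambda>n. ?B (real n)) \<longlonglongrightarrow> 0"
        using tendsto_add[OF lim[of "Suc k"] tendsto_mult_left[OF A(3), of "of_nat (Suc k) / \<mu>"]] by simp
      show "(?B has_vector_derivative - (of_real (t ^ Suc k) * exp (- \<mu> * of_real t))) (at t)" for t
        using has_vector_derivative_add[OF der[of "Suc k" t] has_vector_derivative_mult_right[OF A(2)[of t], of "of_nat (Suc k) / \<mu>"]]
        by (simp add: algebra_simps)
    qed
  }
qed

text \<open>This is Fourier inversion for the sum over n regarded as a function of \<psi> on [0, 1].
  Unfolding over n, the coefficient at e becomes the half-line integral of t^k exp (-(l + 2 pi i e)
  t).\<close>

theorem Lipschitz_summation_formula:
  fixes l :: complex
  assumes l: "Re l > 0" and k: "k \<ge> 1" and \<psi>: "0 \<le> \<psi>" "\<psi> \<le> 1"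
  shows "((\<lambda>e::int. fact k / (l + 2 * pi * \<i> * of_int e) ^ (k + 1) * cis (2 * pi * of_int e * \<psi>)) has_sum
           (\<Sum>n. of_real ((real n + \<psi>) ^ k) * exp (- l * of_real (real n + \<psi>)))) UNIV"
proof -
  define F where "F n t = of_real ((real n + t) ^ k) * exp (- l * of_real (real n + t))" for n and t :: real
  have le: "norm (F n t) \<le> (real n + 1) ^ k * exp (- Re l * real n)" if "t \<in> {0..1}" for n t
    unfolding F_def by (rule norm_shifted_term_le) (use that l in auto)
  have Fs: "summable (\<lambda>n. norm (F n t))" if "0 \<le> t" "t \<le> 1" for t
    by (rule summable_comparison_test'[OF summable_polynomial_exp[OF l, of k], where N = 0]) (use le that in auto)
  have Fc: "continuous_on S (F n)" for n S
    unfolding F_def by (intro continuous_intros)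
  define f where "f t = (\<Sum>n. F n t)" for t
  have hs: "((\<lambda>n. F n t) has_sum f t) UNIV" if "t \<in> {0..1}" for t
    unfolding f_def using Fs[of t] that by (intro norm_summable_imp_has_sum summable_sums summable_norm_cancel[of "\<lambda>n. F n t"]) auto
  have Ms: "(\<lambda>n. (real n + 1) ^ k * exp (- Re l * real n)) summable_on UNIV"
    by (rule summable_nonneg_imp_summable_on[OF summable_polynomial_exp[OF l]]) auto
  have coeff: "((\<lambda>t. f t * cis (- (2 * pi * of_int e * t))) has_integral fact k / (l + 2 * pi * \<i> * of_int e) ^ (k + 1)) {0..1}" for e :: int
  proof -
    define \<mu> where "\<mu> = l + 2 * pi * \<i> * of_int e"
    have \<mu>: "Re \<mu> > 0" using l by (simp add: \<mu>_def)
    obtain A where A: "A 0 = fact k / \<mu> ^ (k + 1)"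
      "\<And>t. (A has_vector_derivative - (of_real (t ^ k) * exp (- \<mu> * of_real t))) (at t)"
      "(\<lambda>n. A (real n)) \<longlonglongrightarrow> 0"
      using exp_power_antiderivative[OF \<mu>] by blast
    \<comment> \<open>Since exp (-2 pi i e n) = 1, the phase may be evaluated at n + t instead of t
      and absorbed into the exponent \<mu>.\<close>
    have eq: "F n t * cis (- (2 * pi * of_int e * t)) = of_real ((real n + t) ^ k) * exp (- \<mu> * of_real (real n + t))" for n t
    proof -
      have "exp (- (2 * pi * \<i> * of_int e * of_nat n)) = 1"
        using exp_eq_1[of "- (2 * pi * \<i> * of_int e * of_nat n)"]
        by (auto intro!: exI[of _ "- (e * int n)"])
      moreover have "- \<mu> * of_real (real n + t) = - l * of_real (real n + t)
          + \<i> * of_real (- (2 * pi * of_int e * t)) + - (2 * pi * \<i> * of_int e * of_nat n)"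
        by (simp add: \<mu>_def algebra_simps)
      ultimately show ?thesis
        unfolding F_def cis_conv_exp by (simp only: exp_add mult_1_right mult.assoc)
    qed
    have int: "((\<lambda>t. F n t * cis (- (2 * pi * of_int e * t))) has_integral A (real n) - A (real (Suc n))) {0..1}" for n
    proof -
      have "((\<lambda>t. F n t * cis (- (2 * pi * of_int e * t))) has_integral - A (real n + 1) - - A (real n + 0)) {0..1}"
      proof (rule fundamental_theorem_of_calculus)
        fix t :: real
        have "((A \<circ> (\<lambda>t. real n + t)) has_vector_derivative 1 *\<^sub>R - (of_real ((real n + t) ^ k) * exp (- \<mu> * of_real (real n + t)))) (at t)"
        proof (rule vector_diff_chain_at[OF _ A(2)])
          show "((\<lambda>t. real n + t) has_vector_derivative 1) (at t)"
            by (auto intro!: derivative_eq_intros)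
        qed
        from has_vector_derivative_at_within[OF has_vector_derivative_minus[OF this], of "{0..1}"]
        show "((\<lambda>t. - A (real n + t)) has_vector_derivative F n t * cis (- (2 * pi * of_int e * t))) (at t within {0..1})"
          unfolding eq by (simp add: o_def)
      qed simp
      then show ?thesis by (simp add: add.commute)
    qed
    have "((\<lambda>n. A (real n) - A (real (Suc n))) has_sum integral {0..1} (\<lambda>t. f t * cis (- (2 * pi * of_int e * t)))) UNIV"
    proof (rule has_sum_integral_m_test(2)[OF _ _ Ms int])
      show "continuous_on {0..1} (\<lambda>t. F n t * cis (- (2 * pi * of_int e * t)))" for n
        unfolding cis_conv_exp by (intro continuous_intros Fc)
      show "norm (F n t * cis (- (2 * pi * of_int e * t))) \<le> (real n + 1) ^ k * exp (- Re l * real n)" if "t \<in> {0..1}" for n t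
        using le[OF that] by (simp add: norm_mult)
      show "((\<lambda>n. F n t * cis (- (2 * pi * of_int e * t))) has_sum f t * cis (- (2 * pi * of_int e * t))) UNIV" if "t \<in> {0..1}" for t
        by (intro has_sum_cmult_left hs that)
    qed
    from has_sum_imp_sums[OF this] have "(\<lambda>n. A (real n) - A (real (Suc n))) sums integral {0..1} (\<lambda>t. f t * cis (- (2 * pi * of_int e * t)))" .
    moreover have "(\<lambda>n. A (real n) - A (real (Suc n))) sums (A (real 0) - 0)"
      by (rule telescope_sums'[OF A(3)])
    ultimately have "integral {0..1} (\<lambda>t. f t * cis (- (2 * pi * of_int e * t))) = A 0"
      using sums_unique2 by fastforce
    moreover have "(\<lambda>t. f t * cis (- (2 * pi * of_int e * t))) integrable_on {0..1}"
    proof (rule integrable_continuous_real)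
      have "continuous_on {0..1} f"
        by (rule has_sum_integral_m_test(1)[OF Fc le Ms integrable_integral[OF integrable_continuous_real[OF Fc]] hs])
      then show "continuous_on {0..1} (\<lambda>t. f t * cis (- (2 * pi * of_int e * t)))"
        unfolding cis_conv_exp by (intro continuous_intros)
    qed
    ultimately show ?thesis using A(1) by (simp add: has_integral_iff \<mu>_def)
  qed
  have "((\<lambda>e::int. fact k / (l + 2 * pi * \<i> * of_int e) ^ (k + 1) * cis (2 * pi * of_int e * \<psi>)) has_sum f \<psi>) UNIV"
  proof (rule Fourier_series_has_sum[OF _ _ coeff])
    show "continuous_on {0..1} f"
      by (rule has_sum_integral_m_test(1)[OF Fc le Ms integrable_integral[OF integrable_continuous_real[OF Fc]] hs])
    \<comment> \<open>The end values match because the term n = 0 vanishes at t = 0, as k >= 1, and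
      the later terms at 0 are those at 1 with n shifted.\<close>
    have "f 0 = F 0 0 + (\<Sum>n. F (Suc n) 0)"
      unfolding f_def using suminf_split_head[OF summable_norm_cancel[OF Fs[of 0]]] by simp
    also have "F 0 0 = 0" using k by (simp add: F_def)
    also have "(\<Sum>n. F (Suc n) 0) = f 1" by (simp add: f_def F_def add.commute)
    finally show "f 0 = f 1" by simp
    show "(\<lambda>e::int. norm (fact k / (l + 2 * pi * \<i> * of_int e) ^ (k + 1))) summable_on UNIV"
      by (rule summable_on_inverse_power_vertical_line) (use l k in auto)
  qed (use \<psi> in auto)
  then show ?thesis by (simp add: f_def F_def)
qed

section \<open>Conditionally convergent lattice sums\<close>

lemma has_sum_diff:
  fixes f g :: "'a \<Rightarrow> 'b :: topological_ab_group_add"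
  assumes "(f has_sum a) A" "(g has_sum b) A"
  shows "((\<lambda>x. f x - g x) has_sum (a - b)) A"
proof -
  have "((\<lambda>x. - g x) has_sum - b) A"
    using assms(2) by (simp add: has_sum_uminus)
  from has_sum_add[OF assms(1) this] show ?thesis by simp
qed

lemma has_sum_int_split3:
  fixes f :: "int \<Rightarrow> complex"
  assumes "((\<lambda>n. f (int n + 1)) has_sum a) UNIV" "((\<lambda>n. f (- (int n + 1))) has_sum b) UNIV"
  shows "(f has_sum a + b + f 0) UNIV"
proof -
  have "(f has_sum a) (range (\<lambda>n. int n + 1))"
    using assms(1) by (subst has_sum_reindex) (simp_all add: o_def inj_on_def)
  moreover have "(f has_sum b) (range (\<lambda>n. - (int n + 1)))"
    using assms(2) by (subst has_sum_reindex) (simp_all add: o_def inj_on_def)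
  ultimately have "(f has_sum a + b) (range (\<lambda>n. int n + 1) \<union> range (\<lambda>n. - (int n + 1)))"
    by (rule has_sum_Un_disjoint) auto
  moreover have "(f has_sum f 0) {0}" by (rule has_sum_finiteI) auto
  ultimately have "(f has_sum a + b + f 0) (range (\<lambda>n. int n + 1) \<union> range (\<lambda>n. - (int n + 1)) \<union> {0})"
    by (rule has_sum_Un_disjoint) auto
  moreover have "e \<in> range (\<lambda>n. int n + 1) \<union> range (\<lambda>n. - (int n + 1)) \<union> {0}" for e :: int
  proof -
    consider "e > 0" | "e < 0" | "e = 0" by linarith
    then show ?thesis
    proof cases
      case 1 then have "e = int (nat (e - 1)) + 1" by simp
      then show ?thesis by blast
    next
      case 2 then have "e = - (int (nat (- e - 1)) + 1)" by simp
      then show ?thesis by blast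
    qed auto
  qed
  then have "range (\<lambda>n. int n + 1) \<union> range (\<lambda>n. - (int n + 1)) \<union> {0} = UNIV" by blast
  ultimately show ?thesis by simp
qed

lemma has_sum_int_split2:
  fixes f :: "int \<Rightarrow> complex"
  assumes "((\<lambda>n. f (- int n)) has_sum a) UNIV" "((\<lambda>n. f (int n + 1)) has_sum b) UNIV"
  shows "(f has_sum a + b) UNIV"
proof -
  have "(f has_sum a) (range (\<lambda>n. - int n))"
    using assms(1) by (subst has_sum_reindex) (simp_all add: o_def inj_on_def)
  moreover have "(f has_sum b) (range (\<lambda>n. int n + 1))"
    using assms(2) by (subst has_sum_reindex) (simp_all add: o_def inj_on_def)
  ultimately have "(f has_sum a + b) (range (\<lambda>n. - int n) \<union> range (\<lambda>n. int n + 1))"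
    by (rule has_sum_Un_disjoint) auto
  moreover have "e \<in> range (\<lambda>n. - int n) \<union> range (\<lambda>n. int n + 1)" for e :: int
  proof (cases "e > 0")
    case True then have "e = int (nat (e - 1)) + 1" by simp
    then show ?thesis by blast
  next
    case False then have "e = - int (nat (- e))" by simp
    then show ?thesis by blast
  qed
  then have "range (\<lambda>n. - int n) \<union> range (\<lambda>n. int n + 1) = UNIV" by blast
  ultimately show ?thesis by simp
qed

lemma summable_on_times_product:
  fixes f :: "'a \<Rightarrow> real" and g :: "'b \<Rightarrow> real"
  assumes "f summable_on A" "g summable_on B" "\<And>x. f x \<ge> 0" "\<And>y. g y \<ge> 0"
  shows "(\<lambda>(x, y). f x * g y) summable_on A \<times> B"
proof (rule summable_on_SigmaI)
  show "((\<lambda>y. case (x, y) of (x, y) \<Rightarrow> f x * g y) has_sum f x * infsum g B) B" for x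
    using assms(2) by (simp add: has_sum_cmult_right)
  show "(\<lambda>x. f x * infsum g B) summable_on A"
    using assms(1) by (rule summable_on_cmult_left)
qed (use assms in auto)

text \<open>As u (e + 1) = \<omega> u e, shifting e multiplies a twisted sum by \<omega>; hence the
  sum of u e (X e - X (e - 1)) is 1 - \<omega> times the sum of u e X e. Applied to rows and to
  columns, this needs an interchange only for the differenced family, and 1 - \<omega> is cancelled
  at the end.\<close>

lemma has_sum_swap_twisted:
  fixes h :: "int \<Rightarrow> 'j \<Rightarrow> complex"
  assumes u: "\<And>e. u (e + 1) = \<omega> * u e" and \<omega>: "\<omega> \<noteq> 1"
    and row: "\<And>e. (h e has_sum R e) UNIV" and T: "((\<lambda>e. u e * R e) has_sum T) UNIV"
    and col: "\<And>j. ((\<lambda>e. u e * h e j) has_sum C j) UNIV"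
    and D: "(\<lambda>(e, j). u e * (h e j - h (e - 1) j)) summable_on UNIV \<times> UNIV"
  shows "(C has_sum T) UNIV"
proof -
  have shift: "((\<lambda>e. u e * X (e - 1)) has_sum \<omega> * S) UNIV"
    if "((\<lambda>e. u e * X e) has_sum S) UNIV" for X S
  proof -
    have "((\<lambda>e. u e * X (e - 1)) has_sum \<omega> * S) UNIV \<longleftrightarrow> ((\<lambda>e. \<omega> * (u e * X e)) has_sum \<omega> * S) UNIV"
    proof (rule has_sum_reindex_bij_witness[where i = "\<lambda>e. e + 1" and j = "\<lambda>e. e - 1"])
      show "\<omega> * (u (e - 1) * X (e - 1)) = u e * X (e - 1)" for e using u[of "e - 1"] by simp
    qed auto
    with has_sum_cmult_right[OF that] show ?thesis by simp
  qed
  obtain S where S: "((\<lambda>(e, j). u e * (h e j - h (e - 1) j)) has_sum S) (UNIV \<times> UNIV)"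
    using D by (auto simp: summable_on_def)
  have "((\<lambda>e. u e * (R e - R (e - 1))) has_sum S) UNIV"
    by (rule has_sum_SigmaD[OF S]) (simp only: prod.case, intro has_sum_cmult_right has_sum_diff row)
  moreover have "((\<lambda>e. u e * (R e - R (e - 1))) has_sum T - \<omega> * T) UNIV"
    unfolding right_diff_distrib by (intro has_sum_diff shift T)
  ultimately have "S = T - \<omega> * T" by (rule has_sum_unique)
  moreover have "((\<lambda>(j, e). u e * (h e j - h (e - 1) j)) has_sum S) (UNIV \<times> UNIV)"
    using S by (subst has_sum_swap) simp
  then have "((\<lambda>j. C j - \<omega> * C j) has_sum S) UNIV"
    by (rule has_sum_SigmaD)
       (simp only: prod.case right_diff_distrib, intro has_sum_diff shift[of "\<lambda>e. h e j" for j] col)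
  ultimately have "((\<lambda>j. (1 - \<omega>) * C j) has_sum (1 - \<omega>) * T) UNIV"
    by (simp only: left_diff_distrib mult_1_left)
  then show ?thesis
    using \<omega> by (simp add: has_sum_cmult_right_iff)
qed

lemma summable_on_lambert:
  fixes \<theta> \<psi> \<beta> :: real
  assumes \<beta>: "\<beta> > 0" and \<theta>: "0 < \<theta>" "\<theta> \<le> 1" and \<psi>: "0 < \<psi>" "\<psi> \<le> 1"
  shows "(\<lambda>(m, n). (real n + \<psi>) ^ k * exp (- \<beta> * (real m + \<theta>) * (real n + \<psi>))) summable_on UNIV \<times> UNIV"
proof -
  \<comment> \<open>Bounding the exponential with exponent k + 2 leaves N^(-2) and M^(-(k+2)) for N
    = n + \<psi>, M = m + \<theta>; the powers of \<psi> and \<theta> come from N >= \<psi> (1 + n)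
    and M >= \<theta> (1 + m).\<close>
  define c where "c = fact (k + 2) / (\<beta> ^ (k + 2) * \<theta> ^ (k + 2) * \<psi> ^ 2)"
  have s: "(\<lambda>(m, n). (c * (1 + real m) powr (- 2)) * (1 + real n) powr (- 2)) summable_on UNIV \<times> UNIV"
    by (intro summable_on_times_product summable_on_cmult_right summable_on_nat_powr)
       (use assms in \<open>auto simp: c_def\<close>)
  show ?thesis
  proof (rule summable_on_comparison_test[OF s], safe)
    fix m n :: nat
    define M where "M = real m + \<theta>"
    define N where "N = real n + \<psi>"
    have M: "M > 0" "\<theta> * (1 + real m) \<le> M" and N: "N > 0" "\<psi> * (1 + real n) \<le> N"
      using \<theta> \<psi> by (auto simp: M_def N_def distrib_left mult_left_le_one_le)
    have "N ^ k * exp (- (\<beta> * M * N)) \<le> N ^ k * (fact (k + 2) / (\<beta> * M * N) ^ (k + 2))"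
      using M N \<beta> by (intro mult_left_mono exp_minus_le_fact_div_power) auto
    also have "\<dots> = fact (k + 2) / (\<beta> ^ (k + 2) * M ^ (k + 2) * N ^ 2)"
      using M N \<beta> by (simp add: power_mult_distrib power2_eq_square)
    also have "\<dots> \<le> fact (k + 2) / (\<beta> ^ (k + 2) * (\<theta> ^ (k + 2) * (1 + real m) ^ 2) * (\<psi> * (1 + real n)) ^ 2)"
    proof -
      have "\<theta> ^ (k + 2) * (1 + real m) ^ 2 \<le> \<theta> ^ (k + 2) * (1 + real m) ^ (k + 2)"
        using \<theta> by (intro mult_left_mono power_increasing) auto
      also have "\<dots> \<le> M ^ (k + 2)"
        unfolding power_mult_distrib[symmetric] using M \<theta> by (intro power_mono) auto
      finally show ?thesis
        using M N \<theta> \<psi> \<beta> by (intro divide_left_mono mult_mono power_mono mult_pos_pos zero_less_power) auto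
    qed
    also have "\<dots> = (c * (1 + real m) powr (- 2)) * (1 + real n) powr (- 2)"
      unfolding power_mult_distrib[of \<psi>] using \<theta> \<psi> \<beta> by (simp add: c_def powr_minus powr_numeral field_simps)
    finally show "(real n + \<psi>) ^ k * exp (- \<beta> * (real m + \<theta>) * (real n + \<psi>)) \<le>
        (c * (1 + real m) powr (- 2)) * (1 + real n) powr (- 2)"
      by (simp add: M_def N_def)
  qed (use \<psi> in auto)
qed

section \<open>The translated lattice y Z + 2 pi i (Z - \<theta>)\<close>

definition lattice_term :: "nat \<Rightarrow> real \<Rightarrow> real \<Rightarrow> int \<Rightarrow> complex" where
  "lattice_term p \<theta> w j = 1 / (of_real w + 2 * pi * \<i> * of_real (of_int j - \<theta>)) ^ p"

text \<open>Because \<theta> is not an integer, the imaginary part stays away from 0 and grows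
  linearly in j, uniformly in e; this covers the row e = 0 as well. The real part controls
  e.\<close>

lemma linear_bound_lattice:
  fixes \<theta> y :: real
  assumes \<theta>: "0 < \<theta>" "\<theta> < 1" and y: "y > 0"
  obtains K where "K > 0"
    "\<And>e j. 1 + \<bar>of_int j\<bar> \<le> K * norm (of_real (y * of_int e) + 2 * pi * \<i> * of_real (of_int j - \<theta>))"
    "\<And>e j. 1 + \<bar>of_int e\<bar> \<le> K * norm (of_real (y * of_int e) + 2 * pi * \<i> * of_real (of_int j - \<theta>))"
proof
  \<comment> \<open>The first entry serves j <= 0, where |j - \<theta>| = |j| + \<theta>. The second
    serves j >= 1, where j - \<theta> >= (1 - \<theta>) j and 1 + j <= 2 j.\<close>
  define \<delta> where "\<delta> = min \<theta> ((1 - \<theta>) / 2)"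
  have \<delta>: "\<delta> > 0" "\<delta> \<le> \<theta>" "\<delta> \<le> (1 - \<theta>) / 2"
    unfolding \<delta>_def by (use \<theta> in simp, rule min.cobounded1, rule min.cobounded2)
  define K where "K = 1 / \<delta> + 1 / y"
  show "K > 0" using \<delta> y by (simp add: K_def add_pos_pos)
  fix e j :: int
  define z where "z = of_real (y * of_int e) + 2 * pi * \<i> * of_real (of_int j - \<theta>)"
  have "\<delta> * (1 + \<bar>of_int j\<bar>) \<le> \<bar>of_int j - \<theta>\<bar>"
  proof (cases "j \<le> 0")
    case True
    then have j: "\<bar>real_of_int j\<bar> = - of_int j" by simp
    have "\<delta> * (1 + \<bar>of_int j\<bar>) \<le> \<theta> * (1 + \<bar>of_int j\<bar>)" using \<delta> by (intro mult_right_mono) auto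
    also have "\<dots> \<le> \<theta> + \<bar>of_int j\<bar>" using \<theta> by (simp add: distrib_left mult_left_le_one_le)
    also have "\<dots> = \<bar>of_int j - \<theta>\<bar>" using True \<theta> unfolding j by simp
    finally show ?thesis .
  next
    case False
    then have j: "real_of_int j \<ge> 1" by linarith
    have "\<delta> * (1 + \<bar>of_int j\<bar>) \<le> (1 - \<theta>) / 2 * (2 * of_int j)"
      using \<delta> j \<theta> by (intro mult_mono) auto
    also have "\<dots> = of_int j - \<theta> * of_int j" by (simp add: field_simps)
    also have "\<dots> \<le> of_int j - \<theta>" using j \<theta> by simp
    finally show ?thesis using j \<theta> by simp
  qed
  also have "\<dots> \<le> 2 * pi * \<bar>of_int j - \<theta>\<bar>" using pi_gt3 by (intro mult_le_cancel_right1[THEN iffD2]) auto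
  also have "\<dots> = \<bar>Im z\<bar>" by (simp add: z_def abs_mult)
  also have "\<dots> \<le> norm z" by (rule abs_Im_le_cmod)
  finally have 1: "\<delta> * (1 + \<bar>of_int j\<bar>) \<le> norm z" .
  then have 2: "1 + \<bar>of_int j\<bar> \<le> norm z / \<delta>" using \<delta> by (simp add: field_simps)
  have "norm z / \<delta> \<le> K * norm z" using y by (simp add: K_def algebra_simps)
  with 2 show "1 + \<bar>of_int j\<bar> \<le> K * norm (of_real (y * of_int e) + 2 * pi * \<i> * of_real (of_int j - \<theta>))"
    by (simp add: z_def)
  have "y * \<bar>of_int e\<bar> = \<bar>Re z\<bar>" using y by (simp add: z_def abs_mult)
  also have "\<dots> \<le> norm z" by (rule abs_Re_le_cmod)
  finally have "\<bar>of_int e\<bar> \<le> norm z / y" using y by (simp add: field_simps)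
  moreover have "1 \<le> norm z / \<delta>" using 2 by linarith
  ultimately show "1 + \<bar>of_int e\<bar> \<le> K * norm (of_real (y * of_int e) + 2 * pi * \<i> * of_real (of_int j - \<theta>))"
    unfolding z_def[symmetric] by (simp add: K_def algebra_simps)
qed

lemma norm_power_diff_le:
  fixes a b :: complex
  assumes "norm a \<le> M" "norm b \<le> M"
  shows "norm (a ^ p - b ^ p) \<le> norm (a - b) * (real p * M ^ (p - 1))"
proof (cases p)
  case (Suc q)
  have M: "M \<ge> 0" using assms norm_ge_zero order_trans by blast
  have "a ^ p - b ^ p = (a - b) * (\<Sum>i<Suc q. a ^ i * b ^ (q - i))"
    unfolding Suc by (rule diff_power_eq_sum)
  moreover have "norm (\<Sum>i<Suc q. a ^ i * b ^ (q - i)) \<le> (\<Sum>i<Suc q. M ^ q)"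
  proof (rule sum_norm_le)
    fix i assume "i \<in> {..<Suc q}"
    then have "M ^ i * M ^ (q - i) = M ^ q" by (simp flip: power_add)
    moreover have "norm (a ^ i * b ^ (q - i)) \<le> M ^ i * M ^ (q - i)"
      unfolding norm_mult norm_power using assms M by (intro mult_mono power_mono) auto
    ultimately show "norm (a ^ i * b ^ (q - i)) \<le> M ^ q" by simp
  qed
  ultimately show ?thesis using Suc by (simp add: norm_mult mult_left_mono)
qed simp

text \<open>Taking the difference in one lattice direction gains one power, which makes the double
  series converge absolutely even in the borderline case \<open>p = 2\<close>.\<close>

lemma summable_on_lattice_difference:
  fixes \<theta> y :: real
  assumes \<theta>: "0 < \<theta>" "\<theta> < 1" and y: "y > 0" and p: "p \<ge> 2" and u: "\<And>e. norm (u e) = 1"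
  shows "(\<lambda>(e, j). u e * (lattice_term p \<theta> (y * of_int e) j - lattice_term p \<theta> (y * of_int (e - 1)) j))
    summable_on UNIV \<times> UNIV"
proof -
  obtain K where K: "K > 0"
    "\<And>e j. 1 + \<bar>of_int j\<bar> \<le> K * norm (of_real (y * of_int e) + 2 * pi * \<i> * of_real (of_int j - \<theta>))"
    "\<And>e j. 1 + \<bar>of_int e\<bar> \<le> K * norm (of_real (y * of_int e) + 2 * pi * \<i> * of_real (of_int j - \<theta>))"
    using linear_bound_lattice[OF \<theta> y] by blast
  define c where "c = y * real p * (2 * K) ^ (p + 1)"
  \<comment> \<open>The two linear bounds are combined by a geometric mean: 1 / |z| <= K q e q j.
    With p + 1 >= 3 such factors, each variable contributes the summable exponent 3/2.\<close>
  define q where "q e = (1 + \<bar>real_of_int e\<bar>) powr (- 1 / 2)" for e :: int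
  have q: "0 < q e" "q e \<le> 1" for e
  proof -
    show "0 < q e" by (simp add: q_def add_pos_nonneg)
    have "(1 + \<bar>real_of_int e\<bar>) powr (- 1 / 2) \<le> 1 powr (- 1 / 2)"
      by (rule powr_mono2') auto
    then show "q e \<le> 1" by (simp add: q_def)
  qed
  have q2: "q e ^ 2 = 1 / (1 + \<bar>of_int e\<bar>)" for e
    by (simp add: q_def power2_eq_square powr_minus inverse_eq_divide flip: powr_add)
  have q3: "q e ^ 3 = (1 + \<bar>of_int e\<bar>) powr (- (3 / 2))" for e
    by (simp add: q_def powr_power)
  have s: "(\<lambda>(e, j). (c * q e ^ 3) * q j ^ 3) summable_on UNIV \<times> UNIV"
    unfolding q3 by (intro summable_on_times_product summable_on_cmult_right summable_on_int_powr)
       (use K y in \<open>auto simp: c_def\<close>)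
  have inv: "norm (1 / (of_real (y * of_int e) + 2 * pi * \<i> * of_real (of_int j - \<theta>))) \<le> K * (q e * q j)" for e j
  proof -
    define z where "z = of_real (y * of_int e) + 2 * pi * \<i> * of_real (of_int j - \<theta>)"
    have "(1 + \<bar>of_int e\<bar>) * (1 + \<bar>of_int j\<bar>) \<le> (K * norm z) * (K * norm z)"
      unfolding z_def using K by (intro mult_mono) auto
    moreover have "0 < (1 + \<bar>of_int e\<bar>) * (1 + \<bar>real_of_int j\<bar>)" by (intro mult_pos_pos) auto
    moreover from calculation have "norm z > 0" by (cases "z = 0") auto
    ultimately have "(1 / norm z) ^ 2 \<le> K ^ 2 * (1 / (1 + \<bar>of_int e\<bar>) * (1 / (1 + \<bar>of_int j\<bar>)))"
      by (simp add: field_simps power2_eq_square)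
    then have "(1 / norm z) ^ 2 \<le> (K * (q e * q j)) ^ 2" by (simp add: power_mult_distrib q2)
    then have "1 / norm z \<le> K * (q e * q j)"
      by (rule power2_le_imp_le) (use K q in \<open>auto intro!: mult_nonneg_nonneg less_imp_le\<close>)
    then show ?thesis by (simp add: z_def norm_divide)
  qed
  have shift: "q (e - 1) \<le> 2 * q e" for e
  proof -
    have "1 / (1 + \<bar>real_of_int (e - 1)\<bar>) \<le> 4 * (1 / (1 + \<bar>of_int e\<bar>))"
      by (simp add: divide_simps)
    then have "q (e - 1) ^ 2 \<le> (2 * q e) ^ 2" by (simp add: q2 power_mult_distrib)
    then show ?thesis by (rule power2_le_imp_le) (use q[of e] in auto)
  qed
  have "(\<lambda>x. norm (case x of (e, j) \<Rightarrow> u e * (lattice_term p \<theta> (y * of_int e) j - lattice_term p \<theta> (y * of_int (e - 1)) j)))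
    summable_on UNIV \<times> UNIV"
  proof (rule Infinite_Sum.abs_summable_on_comparison_test'[OF s], safe)
    fix e j :: int
    define z where "z = of_real (y * of_int e) + 2 * pi * \<i> * of_real (of_int j - \<theta>)"
    define z' where "z' = of_real (y * of_int (e - 1)) + 2 * pi * \<i> * of_real (of_int j - \<theta>)"
    \<comment> \<open>The factor 2 absorbs the shift q (e - 1) <= 2 q e, so that M bounds the
      reciprocals of both neighbouring lattice points.\<close>
    define M where "M = 2 * K * (q e * q j)"
    have M: "0 < M" using K q by (simp add: M_def)
    have a: "norm (1 / z) \<le> M"
    proof -
      have "K * (q e * q j) \<le> 2 * (K * (q e * q j))" using q[of e] q[of j] K by simp
      with inv[of e j] show ?thesis by (simp add: z_def M_def)
    qed
    have "K * (q (e - 1) * q j) \<le> K * ((2 * q e) * q j)"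
      using K q[of j] shift[of e] by (intro mult_left_mono mult_right_mono) auto
    with inv[of "e - 1" j] have b: "norm (1 / z') \<le> M" by (simp add: z'_def M_def)
    have nz: "z \<noteq> 0" "z' \<noteq> 0" using K(2)[of j e] K(2)[of j "e - 1"] by (auto simp: z_def z'_def)
    have "1 / z - 1 / z' = - of_real y * (1 / z) * (1 / z')"
      using nz by (simp add: field_simps) (simp add: z_def z'_def algebra_simps)
    then have "norm (1 / z - 1 / z') = y * (norm (1 / z) * norm (1 / z'))" using y by (simp add: norm_mult norm_divide)
    also have "\<dots> \<le> y * (M * M)" using a b y M by (intro mult_left_mono mult_mono) auto
    finally have d: "norm (1 / z - 1 / z') \<le> y * (M * M)" .
    have "norm ((1 / z) ^ p - (1 / z') ^ p) \<le> norm (1 / z - 1 / z') * (real p * M ^ (p - 1))"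
      by (rule norm_power_diff_le[OF a b])
    also have "\<dots> \<le> y * (M * M) * (real p * M ^ (p - 1))" using d M by (intro mult_right_mono) auto
    also have "\<dots> = y * real p * M ^ (p + 1)" using p by (cases p) auto
    also have "\<dots> = c * (q e * q j) ^ (p + 1)" by (simp add: M_def c_def power_mult_distrib)
    also have "\<dots> \<le> c * (q e * q j) ^ 3"
    proof -
      have "q e * q j \<le> 1" using q[of e] q[of j] by (simp add: mult_le_one)
      then have "(q e * q j) ^ (p + 1) \<le> (q e * q j) ^ 3"
        using q[of e] q[of j] p by (intro power_decreasing) auto
      then show ?thesis using K y by (intro mult_left_mono) (auto simp: c_def)
    qed
    finally show "norm (u e * (lattice_term p \<theta> (y * of_int e) j - lattice_term p \<theta> (y * of_int (e - 1)) j)) \<le> (c * q e ^ 3) * q j ^ 3"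
      by (simp add: norm_mult u lattice_term_def power_one_over power_mult_distrib mult_ac z_def z'_def)
  qed
  then show ?thesis by (rule abs_summable_summable)
qed

section \<open>Lambert series as row and column sums of the lattice\<close>

definition lambert :: "nat \<Rightarrow> real \<Rightarrow> real \<Rightarrow> real \<Rightarrow> real" where
  "lambert k \<beta> \<theta> \<psi> = (\<Sum>\<^sub>\<infinity>(m, n). (real n + \<psi>) ^ k * exp (- \<beta> * (real m + \<theta>) * (real n + \<psi>)))"

text \<open>Both variables start at 1, and the two phases are added inside one cosine, so this is
  the real part of a series of exponentials, as the lattice rows produce. The divisor sums are
  averages of two such series.\<close>

definition twisted_lambert :: "nat \<Rightarrow> real \<Rightarrow> real \<Rightarrow> real \<Rightarrow> real" where
  "twisted_lambert k y \<theta> \<psi> = (\<Sum>\<^sub>\<infinity>(e, d). real (Suc d) ^ k * exp (- y * real (Suc e) * real (Suc d))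
      * cos (2 * pi * (real (Suc d) * \<theta> + real (Suc e) * \<psi>)))"

lemma has_sum_lambert:
  assumes "\<beta> > 0" "0 < \<theta>" "\<theta> \<le> 1" "0 < \<psi>" "\<psi> \<le> 1"
  shows "((\<lambda>(m, n). (real n + \<psi>) ^ k * exp (- \<beta> * (real m + \<theta>) * (real n + \<psi>))) has_sum lambert k \<beta> \<theta> \<psi>) (UNIV \<times> UNIV)"
  unfolding lambert_def UNIV_Times_UNIV[symmetric]
  by (rule has_sum_infsum[OF summable_on_lambert[OF assms]])

text \<open>The denominator y e - 2 pi i t equals (l + 2 pi i e) / (2 pi i / y) with l = 4 pi^2 t /
  y > 0, so the Lipschitz formula applies in e. This rescaling is the origin of the dual parameter 4
  pi^2 / y and of the power in front.\<close>

lemma has_sum_lattice_column: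
  fixes t \<psi> y :: real
  assumes k: "k \<ge> 1" and t: "t > 0" and y: "y > 0" and \<psi>: "0 \<le> \<psi>" "\<psi> \<le> 1"
  shows "((\<lambda>e::int. cis (2 * pi * of_int e * \<psi>) * (1 / (of_real (y * of_int e) - 2 * pi * \<i> * of_real t) ^ (k + 1))) has_sum
     (2 * pi * \<i> / y) ^ (k + 1) / fact k * of_real (\<Sum>n. (real n + \<psi>) ^ k * exp (- (4 * pi^2 / y) * t * (real n + \<psi>)))) UNIV"
proof -
  define l where "l = 4 * pi^2 / y * t"
  have l: "Re (of_real l) > 0" using t y by (simp add: l_def)
  define c where "c = (2 * pi * \<i> / y) ^ (k + 1) / fact k"
  have "summable (\<lambda>n. (real n + \<psi>) ^ k * exp (- l * (real n + \<psi>)))"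
  proof (rule summable_comparison_test'[OF summable_polynomial_exp, where N = 0])
    show "norm ((real n + \<psi>) ^ k * exp (- l * (real n + \<psi>))) \<le> (real n + 1) ^ k * exp (- l * real n)" for n
      using norm_shifted_term_le[OF l \<psi>, of n k] by (simp add: norm_mult norm_power flip: of_real_mult of_real_add exp_of_real)
         (simp add: power_abs abs_mult)
  qed (use l in simp)
  then have "of_real (\<Sum>n. (real n + \<psi>) ^ k * exp (- l * (real n + \<psi>)))
     = (\<Sum>n. of_real ((real n + \<psi>) ^ k) * exp (- of_real l * of_real (real n + \<psi>)) :: complex)"
    by (simp only: suminf_of_real of_real_mult exp_of_real[symmetric] of_real_minus)
  with has_sum_cmult_right[OF Lipschitz_summation_formula[OF l k \<psi>], of c]
  have hs: "((\<lambda>e::int. c * (fact k / (of_real l + 2 * pi * \<i> * of_int e) ^ (k + 1) * cis (2 * pi * of_int e * \<psi>))) has_sum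
      c * of_real (\<Sum>n. (real n + \<psi>) ^ k * exp (- l * (real n + \<psi>)))) UNIV" by simp
  have eq: "c * (fact k / (of_real l + 2 * pi * \<i> * of_int e) ^ (k + 1) * cis (2 * pi * of_int e * \<psi>)) =
      cis (2 * pi * of_int e * \<psi>) * (1 / (of_real (y * of_int e) - 2 * pi * \<i> * of_real t) ^ (k + 1))" for e :: int
  proof -
    define w where "w = (of_real l + 2 * pi * \<i> * of_int e :: complex)"
    have "of_real (y * of_int e) - 2 * pi * \<i> * of_real t = w / (2 * pi * \<i> / y)"
      using y by (simp add: w_def l_def field_simps power2_eq_square)
    then have "1 / (of_real (y * of_int e) - 2 * pi * \<i> * of_real t) ^ (k + 1) = (2 * pi * \<i> / y) ^ (k + 1) / w ^ (k + 1)"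
    proof -
      have "1 / (w / X) ^ (k + 1) = X ^ (k + 1) / w ^ (k + 1)" for X :: complex
        by (simp only: power_divide divide_divide_eq_right mult_1_left)
      then show ?thesis using \<open>_ = w / (2 * pi * \<i> / y)\<close> by metis
    qed
    then show ?thesis unfolding w_def[symmetric] c_def by simp
  qed
  show ?thesis
    using hs unfolding eq by (simp add: c_def l_def mult.assoc)
qed

text \<open>The Lipschitz formula in j, at shift 0 and l = w - 2 pi i \<theta>, so that \<theta>
  becomes the phase of the divisor variable. The sum starts at 1 because k >= 1 kills the term n =
  0.\<close>

lemma has_sum_lattice_row:
  fixes w \<theta> :: real
  assumes k: "k \<ge> 1" and w: "w > 0"
  shows "(lattice_term (k + 1) \<theta> w has_sum
    1 / fact k * (\<Sum>n. of_real (real (Suc n) ^ k) * exp (- (of_real w - 2 * pi * \<i> * \<theta>) * of_nat (Suc n)))) UNIV"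
proof -
  define l where "l = of_real w - 2 * pi * \<i> * \<theta>"
  have l: "Re l > 0" using w by (simp add: l_def)
  have "summable (\<lambda>n. of_real ((real n + 0) ^ k) * exp (- l * of_real (real n + 0)))"
    by (rule summable_comparison_test'[OF summable_polynomial_exp[OF l], where N = 0])
       (rule norm_shifted_term_le, use l in auto)
  then have s: "summable (\<lambda>n. of_real (real n ^ k) * exp (- l * of_nat n))" by simp
  have "(\<Sum>n. of_real (real n ^ k) * exp (- l * of_nat n)) = (\<Sum>n. of_real (real (Suc n) ^ k) * exp (- l * of_nat (Suc n)))"
    using suminf_split_head[OF s] k by simp
  with has_sum_cmult_right[OF Lipschitz_summation_formula[OF l k, of 0], of "1 / fact k"]
  have "((\<lambda>e::int. 1 / fact k * (fact k / (l + 2 * pi * \<i> * of_int e) ^ (k + 1))) has_sum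
    1 / fact k * (\<Sum>n. of_real (real (Suc n) ^ k) * exp (- l * of_nat (Suc n)))) UNIV"
    by simp
  moreover have "1 / fact k * (fact k / (l + 2 * pi * \<i> * of_int e) ^ (k + 1)) = lattice_term (k + 1) \<theta> w e" for e :: int
    by (simp add: lattice_term_def l_def algebra_simps)
  ultimately show ?thesis by (simp add: l_def)
qed

text \<open>Conjugating the base is the same as negating it after w -> -w, and an even power ignores
  the negation. Rows with e < 0 are reduced to e > 0 in this way.\<close>

lemma lattice_term_cnj:
  assumes "even p"
  shows "lattice_term p \<theta> (- w) j = cnj (lattice_term p \<theta> w j)"
proof -
  have "cnj (of_real w + 2 * pi * \<i> * of_real (of_int j - \<theta>)) = - (of_real (- w) + 2 * pi * \<i> * of_real (of_int j - \<theta>))"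
    by simp
  then have "cnj ((of_real w + 2 * pi * \<i> * of_real (of_int j - \<theta>)) ^ p) = (of_real (- w) + 2 * pi * \<i> * of_real (of_int j - \<theta>)) ^ p"
    using assms unfolding complex_cnj_power by (metis power_minus_even)
  then show ?thesis unfolding lattice_term_def by (simp only: complex_cnj_divide complex_cnj_one)
qed

text \<open>On this row the real part is 0, outside the range of the Lipschitz formula. Its terms
  are powers of j - \<theta>, and j <= 0 and j >= 1 yield the two Hurwitz series.\<close>

lemma has_sum_lattice_zero_row:
  fixes \<theta> :: real
  assumes k: "odd k" "k \<ge> 1" and \<theta>: "0 < \<theta>" "\<theta> < 1"
  shows "(lattice_term (k + 1) \<theta> 0 has_sum
     of_real ((-1) ^ ((k + 1) div 2) / (2 * pi) ^ (k + 1) * (hurwitz_zeta (real k + 1) \<theta> + hurwitz_zeta (real k + 1) (1 - \<theta>)))) UNIV"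
proof -
  define c where "c = (-1) ^ ((k + 1) div 2) / (2 * pi) ^ (k + 1)"
  have ik: "\<i> ^ (k + 1) = of_real ((-1) ^ ((k + 1) div 2))"
  proof -
    from k(1) have "k + 1 = 2 * ((k + 1) div 2)" by simp
    then have "\<i> ^ (k + 1) = (\<i> ^ 2) ^ ((k + 1) div 2)" by (metis power_mult)
    then show ?thesis by simp
  qed
  have sq: "(-1) ^ ((k + 1) div 2) * (-1) ^ ((k + 1) div 2) = (1::real)"
    by (simp flip: power_mult_distrib)
  have hz: "((\<lambda>n. (real n + \<alpha>) powr (- (real k + 1))) has_sum hurwitz_zeta (real k + 1) \<alpha>) UNIV" if \<alpha>: "0 < \<alpha>" "\<alpha> < 1" for \<alpha>
  proof -
    have "(\<lambda>n. \<alpha> powr (- (real k + 1)) * (1 + real n) powr (- (real k + 1))) summable_on UNIV"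
      by (intro summable_on_cmult_right summable_on_nat_powr) (use k in auto)
    then have s: "(\<lambda>n. (real n + \<alpha>) powr (- (real k + 1))) summable_on UNIV"
    proof (rule summable_on_comparison_test)
      fix n
      have "(real n + \<alpha>) powr (- (real k + 1)) \<le> (\<alpha> * (1 + real n)) powr (- (real k + 1))"
      proof (rule powr_mono2')
        show "0 < \<alpha> * (1 + real n)" using \<alpha> by simp
      qed (use \<alpha> in \<open>auto simp: distrib_left mult_left_le_one_le\<close>)
      then show "(real n + \<alpha>) powr (- (real k + 1)) \<le> \<alpha> powr (- (real k + 1)) * (1 + real n) powr (- (real k + 1))"
        using \<alpha> by (simp add: powr_mult)
    qed auto
    have "hurwitz_zeta (real k + 1) \<alpha> = (\<Sum>\<^sub>\<infinity>n. (real n + \<alpha>) powr (- (real k + 1)))"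
      unfolding hurwitz_zeta_def
      using has_sum_imp_sums[OF has_sum_infsum[OF s]] by (simp add: sums_iff)
    with has_sum_infsum[OF s] show ?thesis by simp
  qed
  \<comment> \<open>The even exponent makes i^(k+1) a real sign and replaces s by |s|, so one
    formula covers both halves of the row.\<close>
  have pw: "1 / (2 * pi * \<i> * of_real s) ^ (k + 1) = of_real (c * \<bar>s\<bar> powr (- (real k + 1)))" if "s \<noteq> 0" for s
  proof -
    have "\<bar>s\<bar> powr (- (real k + 1)) = 1 / s ^ (k + 1)"
    proof -
      have "\<bar>s\<bar> powr (real k + 1) = \<bar>s\<bar> ^ (k + 1)"
        using that by (simp add: powr_add powr_realpow)
      also have "\<dots> = s ^ (k + 1)" using k by (intro power_even_abs) simp
      finally show ?thesis by (simp only: powr_minus_divide)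
    qed
    moreover have "(2 * pi * \<i> * of_real s) ^ (k + 1) = of_real ((2 * pi) ^ (k + 1) * (-1) ^ ((k + 1) div 2) * s ^ (k + 1))"
      unfolding power_mult_distrib ik by simp
    moreover have "1 / ((2 * pi) ^ (k + 1) * (-1) ^ ((k + 1) div 2) * s ^ (k + 1)) = c * (1 / s ^ (k + 1))"
      using sq that by (simp only: c_def divide_simps) (simp add: algebra_simps)
    ultimately show ?thesis by (metis of_real_1 of_real_divide)
  qed
  have "((\<lambda>m. lattice_term (k + 1) \<theta> 0 (- int m)) has_sum of_real (c * hurwitz_zeta (real k + 1) \<theta>)) UNIV"
  proof -
    have "lattice_term (k + 1) \<theta> 0 (- int m) = of_real (c * (real m + \<theta>) powr (- (real k + 1)))" for m
      using pw[of "of_int (- int m) - \<theta>"] \<theta> by (simp add: lattice_term_def add.commute)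
    then show ?thesis
      using has_sum_of_real[OF has_sum_cmult_right[OF hz[OF \<theta>], of c]] by simp
  qed
  moreover have "((\<lambda>m. lattice_term (k + 1) \<theta> 0 (int m + 1)) has_sum of_real (c * hurwitz_zeta (real k + 1) (1 - \<theta>))) UNIV"
  proof -
    have "lattice_term (k + 1) \<theta> 0 (int m + 1) = of_real (c * (real m + (1 - \<theta>)) powr (- (real k + 1)))" for m
      using pw[of "of_int (int m + 1) - \<theta>"] \<theta> by (simp add: lattice_term_def algebra_simps)
    then show ?thesis
      using has_sum_of_real[OF has_sum_cmult_right[OF hz[of "1 - \<theta>"], of c]] \<theta> by simp
  qed
  ultimately have "(lattice_term (k + 1) \<theta> 0 has_sum of_real (c * hurwitz_zeta (real k + 1) \<theta>) + of_real (c * hurwitz_zeta (real k + 1) (1 - \<theta>))) UNIV"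
    by (rule has_sum_int_split2)
  then show ?thesis by (simp add: c_def distrib_left)
qed

section \<open>The transformation formula for twisted Lambert series\<close>

lemma has_sum_twisted_lambert:
  assumes y: "y > 0"
  shows "((\<lambda>(e, d). of_real (real (Suc d) ^ k * exp (- y * real (Suc e) * real (Suc d))) * cis (2 * pi * (real (Suc d) * \<theta> + real (Suc e) * \<psi>)))
      summable_on UNIV \<times> UNIV)"
    and "((\<lambda>(e, d). real (Suc d) ^ k * exp (- y * real (Suc e) * real (Suc d)) * cos (2 * pi * (real (Suc d) * \<theta> + real (Suc e) * \<psi>)))
      has_sum twisted_lambert k y \<theta> \<psi>) (UNIV \<times> UNIV)"
proof -
  have "(\<lambda>(e, d). real (Suc d) ^ k * exp (- y * real (Suc e) * real (Suc d))) summable_on UNIV \<times> UNIV"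
    using summable_on_lambert[OF y, of 1 1 k] by (simp add: add.commute)
  then have 1: "(\<lambda>z. norm (case z of (e, d) \<Rightarrow> complex_of_real (real (Suc d) ^ k * exp (- y * real (Suc e) * real (Suc d))) * cis (2 * pi * (real (Suc d) * \<theta> + real (Suc e) * \<psi>))))
    summable_on UNIV \<times> UNIV"
  proof (rule Infinite_Sum.abs_summable_on_comparison_test', safe)
    fix e d :: nat
    have "0 \<le> real (Suc d) ^ k * exp (- y * real (Suc e) * real (Suc d))" by simp
    then show "norm (complex_of_real (real (Suc d) ^ k * exp (- y * real (Suc e) * real (Suc d))) * cis (2 * pi * (real (Suc d) * \<theta> + real (Suc e) * \<psi>)))
      \<le> real (Suc d) ^ k * exp (- y * real (Suc e) * real (Suc d))"
      by (simp only: norm_mult norm_of_real norm_cis mult_1_right abs_of_nonneg order_refl)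
  qed
  then show 2: "((\<lambda>(e, d). of_real (real (Suc d) ^ k * exp (- y * real (Suc e) * real (Suc d))) * cis (2 * pi * (real (Suc d) * \<theta> + real (Suc e) * \<psi>)))
      summable_on UNIV \<times> UNIV)"
    by (rule abs_summable_summable)
  have eq: "Re (case z of (e, d) \<Rightarrow> of_real (real (Suc d) ^ k * exp (- y * real (Suc e) * real (Suc d))) * cis (2 * pi * (real (Suc d) * \<theta> + real (Suc e) * \<psi>)))
    = (case z of (e, d) \<Rightarrow> real (Suc d) ^ k * exp (- y * real (Suc e) * real (Suc d)) * cos (2 * pi * (real (Suc d) * \<theta> + real (Suc e) * \<psi>)))" for z
    by (cases z) (simp only: prod.case  cis.sel times_complex.sel Re_complex_of_real Im_complex_of_real mult_zero_left diff_zero)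
  show "((\<lambda>(e, d). real (Suc d) ^ k * exp (- y * real (Suc e) * real (Suc d)) * cos (2 * pi * (real (Suc d) * \<theta> + real (Suc e) * \<psi>)))
      has_sum twisted_lambert k y \<theta> \<psi>) (UNIV \<times> UNIV)"
    using summable_on_Re[OF 2] unfolding eq twisted_lambert_def UNIV_Times_UNIV[symmetric]
    by (rule has_sum_infsum)
qed

text \<open>By rows, the lattice sum twisted in e is twice the twisted series over k!, plus the zero
  row. By columns, j <= 0 gives the dual series at (\<theta>, \<psi>) and j >= 1 the one at (1 -
  \<theta>, 1 - \<psi>).\<close>

theorem twisted_lambert_transformation:
  fixes \<theta> \<psi> y :: real
  assumes k: "odd k" "k \<ge> 1" and \<theta>: "0 < \<theta>" "\<theta> < 1" and \<psi>: "0 < \<psi>" "\<psi> < 1" and y: "y > 0"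
  shows "2 * twisted_lambert k y \<theta> \<psi>
      = - (fact k * ((-1) ^ ((k + 1) div 2) / (2 * pi) ^ (k + 1) * (hurwitz_zeta (real k + 1) \<theta> + hurwitz_zeta (real k + 1) (1 - \<theta>))))
        + (-1) ^ ((k + 1) div 2) * (2 * pi / y) ^ (k + 1)
          * (lambert k (4 * pi^2 / y) \<theta> \<psi> + lambert k (4 * pi^2 / y) (1 - \<theta>) (1 - \<psi>))"
proof -
  define u where "u e = cis (2 * pi * of_int e * \<psi>)" for e :: int
  define h where "h e = lattice_term (k + 1) \<theta> (y * of_int e)" for e :: int
  define Z where "Z = (-1) ^ ((k + 1) div 2) / (2 * pi) ^ (k + 1) * (hurwitz_zeta (real k + 1) \<theta> + hurwitz_zeta (real k + 1) (1 - \<theta>))"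
  define r where "r w = 1 / fact k * (\<Sum>n. of_real (real (Suc n) ^ k) * exp (- (of_real w - 2 * pi * \<i> * \<theta>) * of_nat (Suc n)))" for w :: real
  define R where "R e = (if e > 0 then r (y * of_int e) else if e < 0 then cnj (r (y * of_int (- e))) else of_real Z)" for e :: int
  define G where "G = (\<lambda>(e, d). of_real (real (Suc d) ^ k * exp (- y * real (Suc e) * real (Suc d))) * cis (2 * pi * (real (Suc d) * \<theta> + real (Suc e) * \<psi>)))"
  define c where "c = (2 * pi * \<i> / y) ^ (k + 1) / fact k"
  have row: "(h e has_sum R e) UNIV" for e
  proof -
    consider "e > 0" | "e < 0" | "e = 0" by linarith
    then show ?thesis
    proof cases
      case 1
      then show ?thesis
        using has_sum_lattice_row[OF k(2), of "y * of_int e" \<theta>] y by (simp add: h_def R_def r_def)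
    next
      case 2
      then have w: "y * of_int (- e) > 0" using y by (simp add: mult_pos_neg)
      have "h e = (\<lambda>j. cnj (lattice_term (k + 1) \<theta> (y * of_int (- e)) j))"
        using lattice_term_cnj[of "k + 1" \<theta> "y * of_int (- e)"] k by (simp add: h_def fun_eq_iff)
      moreover have "R e = cnj (r (y * of_int (- e)))" using 2 by (simp add: R_def)
      moreover have "((\<lambda>j. cnj (lattice_term (k + 1) \<theta> (y * of_int (- e)) j)) has_sum cnj (r (y * of_int (- e)))) UNIV"
        unfolding has_sum_cnj_iff r_def by (rule has_sum_lattice_row[OF k(2) w])
      ultimately show ?thesis by simp
    next
      case 3
      then show ?thesis
        using has_sum_lattice_zero_row[OF k \<theta>] by (simp add: h_def R_def Z_def)
    qed
  qed
  have G: "(G has_sum infsum G (UNIV \<times> UNIV)) (UNIV \<times> UNIV)"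
    using has_sum_twisted_lambert(1)[OF y] unfolding G_def by (rule has_sum_infsum)
  have Re_G: "Re (infsum G (UNIV \<times> UNIV)) = twisted_lambert k y \<theta> \<psi>"
  proof (rule has_sum_unique[OF has_sum_Re[OF G]])
    show "((\<lambda>x. Re (G x)) has_sum twisted_lambert k y \<theta> \<psi>) (UNIV \<times> UNIV)"
      using has_sum_twisted_lambert(2)[OF y, of k \<theta> \<psi>]
      by (rule has_sum_cong[THEN iffD1, rotated]) (auto simp: G_def)
  qed
  have up: "((\<lambda>n. u (int n + 1) * R (int n + 1)) has_sum 1 / fact k * infsum G (UNIV \<times> UNIV)) UNIV"
  proof (rule has_sum_SigmaD[where B = "\<lambda>_. UNIV"])
    show "((\<lambda>(e, d). 1 / fact k * G (e, d)) has_sum 1 / fact k * infsum G (UNIV \<times> UNIV)) (UNIV \<times> UNIV)"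
      using has_sum_cmult_right[OF G, of "1 / fact k"] by (simp add: case_prod_unfold)
    fix e :: nat
    define v where "v d = of_real (real (Suc d) ^ k) * exp (- (of_real (y * of_int (int e + 1)) - 2 * pi * \<i> * \<theta>) * of_nat (Suc d))" for d
    have Ge: "1 / fact k * G (e, d) = u (int e + 1) / fact k * v d" for d
      by (simp add: v_def G_def u_def cis_conv_exp exp_of_real[symmetric] algebra_simps flip: exp_add)
    have s: "(\<lambda>d. 1 / fact k * G (e, d)) summable_on UNIV"
      using summable_on_SigmaD1[of "\<lambda>e d. G (e, d)" UNIV "\<lambda>_. UNIV" e] G
      by (intro summable_on_cmult_right) (auto simp: summable_on_def)
    \<comment> \<open>Dividing out this nonzero constant transfers summability from a row of G to v,
      which identifies the ordinary series in R with an unordered sum.\<close>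
    have "u (int e + 1) / fact k \<noteq> 0" by (simp add: u_def)
    then have "v summable_on UNIV"
      using s summable_on_cmult_right'[of "u (int e + 1) / fact k" v UNIV] unfolding Ge by blast
    then have "(v has_sum (\<Sum>d. v d)) UNIV"
      using has_sum_infsum has_sum_imp_sums sums_unique by metis
    moreover have "R (int e + 1) = 1 / fact k * (\<Sum>d. v d)"
      unfolding R_def r_def v_def by simp
    ultimately have "((\<lambda>d. 1 / fact k * G (e, d)) has_sum u (int e + 1) * R (int e + 1)) UNIV"
      unfolding Ge using has_sum_cmult_right[of v UNIV "\<Sum>d. v d" "u (int e + 1) / fact k"] by simp
    then show "((\<lambda>d. case (e, d) of (e, d) \<Rightarrow> 1 / fact k * G (e, d)) has_sum u (int e + 1) * R (int e + 1)) UNIV" by simp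
  qed
  have down: "((\<lambda>n. u (- (int n + 1)) * R (- (int n + 1))) has_sum cnj (1 / fact k * infsum G (UNIV \<times> UNIV))) UNIV"
  proof -
    have "u (- (int n + 1)) * R (- (int n + 1)) = cnj (u (int n + 1) * R (int n + 1))" for n
    proof -
      have "u (- e) = cnj (u e)" for e by (simp add: u_def cis_cnj)
      moreover have "R (- (int n + 1)) = cnj (R (int n + 1))" by (simp add: R_def add.commute)
      ultimately show ?thesis by (simp only: complex_cnj_mult)
    qed
    then show ?thesis using up by (simp only: has_sum_cnj_iff)
  qed
  have "((\<lambda>e. u e * R e) has_sum (1 / fact k * infsum G (UNIV \<times> UNIV) + cnj (1 / fact k * infsum G (UNIV \<times> UNIV)) + u 0 * R 0)) UNIV"
    by (rule has_sum_int_split3[OF up down])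
  also have "1 / fact k * infsum G (UNIV \<times> UNIV) + cnj (1 / fact k * infsum G (UNIV \<times> UNIV)) + u 0 * R 0
      = of_real (1 / fact k * (2 * twisted_lambert k y \<theta> \<psi>) + Z)"
  proof -
    have "Re (1 / fact k * infsum G (UNIV \<times> UNIV)) = Re (of_real (1 / fact k) * infsum G (UNIV \<times> UNIV))" by simp
    also have "\<dots> = 1 / fact k * twisted_lambert k y \<theta> \<psi>" by (simp only: Re_G[symmetric] times_complex.sel complex.sel Re_complex_of_real Im_complex_of_real mult_zero_left diff_zero)
    finally show ?thesis unfolding complex_add_cnj by (simp add: u_def R_def)
  qed
  finally have T: "((\<lambda>e. u e * R e) has_sum of_real (1 / fact k * (2 * twisted_lambert k y \<theta> \<psi>) + Z)) UNIV" .

  define q where "q t \<psi> = (\<Sum>n. (real n + \<psi>) ^ k * exp (- (4 * pi^2 / y) * t * (real n + \<psi>)))" for t \<psi>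
  define C where "C j = c * of_real (if j \<le> 0 then q (of_int (- j) + \<theta>) \<psi> else q (of_int j - \<theta>) (1 - \<psi>))" for j :: int
  have col: "((\<lambda>e. u e * h e j) has_sum C j) UNIV" for j
  proof (cases "j \<le> 0")
    case True
    then have "of_int (- j) + \<theta> > 0" using \<theta> by linarith
    from has_sum_lattice_column[OF k(2) this y, of \<psi>] \<psi>
    have "((\<lambda>e. cis (2 * pi * of_int e * \<psi>) * (1 / (of_real (y * of_int e) - 2 * pi * \<i> * of_real (of_int (- j) + \<theta>)) ^ (k + 1))) has_sum
      c * of_real (q (of_int (- j) + \<theta>) \<psi>)) UNIV" by (simp add: c_def q_def)
    moreover have "of_real (y * of_int e) - 2 * pi * \<i> * of_real (of_int (- j) + \<theta>) = of_real (y * of_int e) + 2 * pi * \<i> * of_real (of_int j - \<theta>)" for e :: int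
      by (simp add: algebra_simps)
    ultimately show ?thesis using True by (simp only: u_def h_def lattice_term_def C_def if_True)
  next
    case False
    then have pos: "of_int j - \<theta> > 0" using \<theta> by linarith
    \<comment> \<open>For j >= 1 the imaginary part has the opposite sign to the one in the column
      formula. Reflecting e repairs this, since the power is even, and the reversed phase is that of
      1 - \<psi> because cis (2 pi e) = 1.\<close>
    have "((\<lambda>e. u e * h e j) has_sum C j) UNIV \<longleftrightarrow>
       ((\<lambda>e::int. cis (2 * pi * of_int e * (1 - \<psi>)) * (1 / (of_real (y * of_int e) - 2 * pi * \<i> * of_real (of_int j - \<theta>)) ^ (k + 1))) has_sum C j) UNIV"
    proof (rule has_sum_reindex_bij_witness[where i = uminus and j = uminus])
      fix e :: int
      have "cis (2 * pi * of_int (- e)) = 1" using cis_multiple_2pi[of "of_int (- e)"] by simp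
      then have "cis (2 * pi * of_int (- e) * (1 - \<psi>)) = u e"
        by (simp add: u_def right_diff_distrib flip: cis_mult cis_divide)
      moreover have "(of_real (y * of_int (- e)) - 2 * pi * \<i> * of_real (of_int j - \<theta>)) ^ (k + 1) = (of_real (y * of_int e) + 2 * pi * \<i> * of_real (of_int j - \<theta>)) ^ (k + 1)"
        using power_minus_even[of "k + 1" "of_real (y * of_int e) + 2 * pi * \<i> * of_real (of_int j - \<theta>)"] k by (simp add: algebra_simps)
      ultimately show "cis (2 * pi * of_int (- e) * (1 - \<psi>)) * (1 / (of_real (y * of_int (- e)) - 2 * pi * \<i> * of_real (of_int j - \<theta>)) ^ (k + 1)) = u e * h e j"
        by (simp only: h_def lattice_term_def)
    qed auto
    with has_sum_lattice_column[OF k(2) pos y, of "1 - \<psi>"] \<psi> False show ?thesis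
      by (simp add: C_def c_def q_def)
  qed
  have "(C has_sum of_real (1 / fact k * (2 * twisted_lambert k y \<theta> \<psi>) + Z)) UNIV"
  proof (rule has_sum_swap_twisted[OF _ _ row T col])
    show "u (e + 1) = cis (2 * pi * \<psi>) * u e" for e by (simp add: u_def cis_mult algebra_simps)
    show "cis (2 * pi * \<psi>) \<noteq> 1"
    proof
      assume "cis (2 * pi * \<psi>) = 1"
      then have "cos (2 * pi * \<psi>) = 1" by (simp add: complex_eq_iff)
      then obtain n :: int where "2 * pi * \<psi> = of_int n * 2 * pi" using cos_one_2pi_int by blast
      then have "\<psi> = of_int n" by simp
      with \<psi> show False by simp
    qed
    show "(\<lambda>(e, j). u e * (h e j - h (e - 1) j)) summable_on UNIV \<times> UNIV"
      unfolding h_def by (rule summable_on_lattice_difference) (use \<theta> y k in \<open>auto simp: u_def\<close>)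
  qed
  moreover have lam: "((\<lambda>m. q (real m + \<alpha>) \<phi>) has_sum lambert k (4 * pi^2 / y) \<alpha> \<phi>) UNIV"
    if "0 < \<alpha>" "\<alpha> < 1" "0 < \<phi>" "\<phi> < 1" for \<alpha> \<phi>
  proof -
    have b: "4 * pi^2 / y > 0" using y by simp
    note L = has_sum_lambert[OF b, of \<alpha> \<phi> k]
    have "((\<lambda>n. (real n + \<phi>) ^ k * exp (- (4 * pi^2 / y) * (real m + \<alpha>) * (real n + \<phi>))) has_sum q (real m + \<alpha>) \<phi>) UNIV" for m
    proof -
      have "(\<lambda>n. (real n + \<phi>) ^ k * exp (- (4 * pi^2 / y) * (real m + \<alpha>) * (real n + \<phi>))) summable_on UNIV"
        using summable_on_SigmaD1[of "\<lambda>m n. (real n + \<phi>) ^ k * exp (- (4 * pi^2 / y) * (real m + \<alpha>) * (real n + \<phi>))" UNIV "\<lambda>_. UNIV" m] L that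
        by (auto simp: summable_on_def)
      note * = has_sum_infsum[OF this]
      from * show ?thesis unfolding q_def sums_unique[OF has_sum_imp_sums[OF *], symmetric] .
    qed
    then show ?thesis using L that by (intro has_sum_SigmaD[OF L]) auto
  qed
  have "(C has_sum c * of_real (lambert k (4 * pi^2 / y) \<theta> \<psi>) + c * of_real (lambert k (4 * pi^2 / y) (1 - \<theta>) (1 - \<psi>))) UNIV"
  proof (rule has_sum_int_split2)
    show "((\<lambda>n. C (- int n)) has_sum c * of_real (lambert k (4 * pi^2 / y) \<theta> \<psi>)) UNIV"
      using has_sum_cmult_right[OF has_sum_of_real[OF lam[OF \<theta> \<psi>]], of c] by (simp add: C_def)
    have "q (real n + (1 - \<theta>)) = q (of_int (int n + 1) - \<theta>)" for n by (simp add: algebra_simps)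
    then show "((\<lambda>n. C (int n + 1)) has_sum c * of_real (lambert k (4 * pi^2 / y) (1 - \<theta>) (1 - \<psi>))) UNIV"
      using has_sum_cmult_right[OF has_sum_of_real[OF lam[of "1 - \<theta>" "1 - \<psi>"]], of c] \<theta> \<psi> by (simp add: C_def)
  qed
  ultimately have "of_real (1 / fact k * (2 * twisted_lambert k y \<theta> \<psi>) + Z)
      = c * of_real (lambert k (4 * pi^2 / y) \<theta> \<psi>) + c * of_real (lambert k (4 * pi^2 / y) (1 - \<theta>) (1 - \<psi>))"
    using has_sum_unique by blast
  moreover have "c = of_real ((-1) ^ ((k + 1) div 2) * (2 * pi / y) ^ (k + 1) / fact k)"
  proof -
    from k(1) have "k + 1 = 2 * ((k + 1) div 2)" by simp
    then have "\<i> ^ (k + 1) = (\<i> ^ 2) ^ ((k + 1) div 2)" by (metis power_mult)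
    then have ik: "\<i> ^ (k + 1) = of_real ((-1) ^ ((k + 1) div 2))" by simp
    have "2 * pi * \<i> / y = \<i> * of_real (2 * pi / y)" by simp
    then have "(2 * pi * \<i> / y) ^ (k + 1) = of_real ((-1) ^ ((k + 1) div 2)) * of_real (2 * pi / y) ^ (k + 1)"
      by (simp only: power_mult_distrib ik)
    then show ?thesis unfolding c_def by simp
  qed
  ultimately have "1 / fact k * (2 * twisted_lambert k y \<theta> \<psi>) + Z =
      (-1) ^ ((k + 1) div 2) * (2 * pi / y) ^ (k + 1) / fact k * (lambert k (4 * pi^2 / y) \<theta> \<psi> + lambert k (4 * pi^2 / y) (1 - \<theta>) (1 - \<psi>))"
    by (simp only: distrib_left[symmetric] of_real_add[symmetric] of_real_mult[symmetric] of_real_eq_iff)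
  moreover have "A = - (f * Y) + B * L" if "1 / f * A + Y = B / f * L" "f \<noteq> 0" for f A Y B L :: real
    using that by (simp add: field_simps)
  ultimately show ?thesis unfolding Z_def[symmetric] using fact_nonzero by blast
qed

section \<open>Bessel and Gamma integrals over the real line\<close>

text \<open>The change of variables is made on real and imaginary parts. The measurability
  assumption then carries integrability from Lebesgue measure back to \<open>lborel\<close>.\<close>

lemma integrable_exp_substitution:
  fixes f :: "real \<Rightarrow> complex"
  assumes f: "f absolutely_integrable_on {0<..}" and meas: "(\<lambda>x. of_real (exp x) * f (exp x)) \<in> borel_measurable borel"
  shows "integrable lborel (\<lambda>x. of_real (exp x) * f (exp x))"
    and "(LINT x|lborel. of_real (exp x) * f (exp x)) = integral {0<..} f"
proof -
  define g where "g x = of_real (exp x) * f (exp x)" for x :: real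
  have image: "range exp = {0::real<..}"
  proof -
    have "x \<in> range exp" if "x > 0" for x :: real
      using exp_ln[OF that] by (metis rangeI)
    then show ?thesis by auto
  qed
  have sub: "(\<lambda>x. exp x * r (exp x)) absolutely_integrable_on UNIV \<and> integral UNIV (\<lambda>x. exp x * r (exp x)) = integral {0<..} r"
    if "r absolutely_integrable_on {0<..}" for r :: "real \<Rightarrow> real"
    using has_absolute_integral_change_of_variables_1'[of UNIV exp exp r "integral {0<..} r"] that
    unfolding image by (auto simp: DERIV_exp inj_on_def)
  have fi: "f integrable_on {0<..}" using f set_lebesgue_integral_eq_integral(1) by blast
  have re: "(\<lambda>t. Re (f t)) absolutely_integrable_on {0<..}" and im: "(\<lambda>t. Im (f t)) absolutely_integrable_on {0<..}"
    using absolutely_integrable_linear[OF f bounded_linear_Re] absolutely_integrable_linear[OF f bounded_linear_Im] by (simp_all add: o_def)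
  note r = sub[OF re] and i = sub[OF im]
  have geq: "g = (\<lambda>x. of_real (exp x * Re (f (exp x))) + of_real (exp x * Im (f (exp x))) * \<i>)"
    by (simp add: fun_eq_iff complex_eq_iff g_def)
  have rl: "integrable lebesgue (\<lambda>x. exp x * Re (f (exp x)))" and il: "integrable lebesgue (\<lambda>x. exp x * Im (f (exp x)))"
    using r i by (simp_all add: set_integrable_def)
  have gl: "integrable lebesgue g"
    unfolding geq by (intro Bochner_Integration.integrable_add integrable_mult_left integrable_of_real rl il)
  then show gi: "integrable lborel (\<lambda>x. of_real (exp x) * f (exp x))"
    unfolding g_def[symmetric] using meas integrable_completion[of g lborel] by (simp add: g_def[abs_def])
  have "(g has_integral (LINT x|lborel. g x)) UNIV"
    using gi has_integral_integral_lborel[of g] unfolding g_def[abs_def] by simp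
  then have gI: "(LINT x|lborel. g x) = integral UNIV g" "g integrable_on UNIV"
    by (auto simp: integral_unique)
  have "Re (integral UNIV g) = integral UNIV (\<lambda>x. exp x * Re (f (exp x)))"
    using has_integral_Re[OF integrable_integral[OF gI(2)]] by (simp add: g_def integral_unique)
  moreover have "Im (integral UNIV g) = integral UNIV (\<lambda>x. exp x * Im (f (exp x)))"
    using has_integral_Im[OF integrable_integral[OF gI(2)]] by (simp add: g_def integral_unique)
  moreover have "Re (integral {0<..} f) = integral {0<..} (\<lambda>t. Re (f t))" "Im (integral {0<..} f) = integral {0<..} (\<lambda>t. Im (f t))"
    using has_integral_Re[OF integrable_integral[OF fi]] has_integral_Im[OF integrable_integral[OF fi]] by (simp_all add: integral_unique)
  ultimately show "(LINT x|lborel. of_real (exp x) * f (exp x)) = integral {0<..} f"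
    using r i gI(1) by (simp add: g_def complex_eq_iff)
qed

text \<open>In the logarithmic variable the scale l is removed by translating t by ln l, which costs
  the factor l^(-s).\<close>

lemma Gamma_integral_lborel:
  fixes s :: complex and l :: real
  assumes s: "Re s > 0" and l: "l > 0"
  shows "integrable lborel (\<lambda>t. exp (s * of_real t - of_real (l * exp t)))"
    and "(LINT t|lborel. exp (s * of_real t - of_real (l * exp t))) = Gamma s / of_real l powr s"
proof -
  define f where "f t = of_real t powr (s - 1) / of_real (exp t)" for t :: real
  define F where "F t = exp (s * of_real t - of_real (exp t))" for t :: real
  have f: "f absolutely_integrable_on {0<..}" "integral {0<..} f = Gamma s"
    using absolutely_integrable_Gamma_integral'[OF s] Gamma_integral_complex'[OF s]
    by (simp_all add: f_def[abs_def] integral_unique)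
  have eq: "of_real (exp x) * f (exp x) = F x" for x
  proof -
    have "Ln (exp (of_real x)) = (of_real x :: complex)" by (rule Ln_exp) auto
    then show ?thesis
      by (simp add: f_def F_def powr_def exp_of_real[symmetric] algebra_simps exp_add exp_diff)
  qed
  have m: "F \<in> borel_measurable borel"
    unfolding F_def by measurable
  have F: "integrable lborel F" "(LINT x|lborel. F x) = Gamma s"
    using integrable_exp_substitution[OF f(1)] m f(2) unfolding eq by simp_all
  have G: "exp (s * of_real t - of_real (l * exp t)) = exp (- s * of_real (ln l)) * F (ln l + 1 * t)" for t
  proof -
    have "exp (ln l + 1 * t) = l * exp t" using l by (simp add: exp_add)
    then show ?thesis unfolding F_def by (simp only: exp_add[symmetric]) (simp add: algebra_simps)
  qed
  show "integrable lborel (\<lambda>t. exp (s * of_real t - of_real (l * exp t)))"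
    unfolding G by (intro integrable_mult_right lborel_integrable_real_affine F) simp
  have "(LINT t|lborel. F (ln l + 1 * t)) = Gamma s"
    using lborel_integral_real_affine[of 1 F "ln l"] F(2) by simp
  then have "(LINT t|lborel. exp (s * of_real t - of_real (l * exp t))) = exp (- s * of_real (ln l)) * Gamma s"
    unfolding G by simp
  also have "\<dots> = Gamma s / of_real l powr s"
    using l by (simp add: powr_def exp_minus Ln_of_real field_simps)
  finally show "(LINT t|lborel. exp (s * of_real t - of_real (l * exp t))) = Gamma s / of_real l powr s" .
qed

text \<open>With u = exp t this is the integrand u^(\<nu>-1) exp (-u - q / u) du, whose integral is
  2 q^(\<nu>/2) K at 2 sqrt q. At q = 0 it is the Gamma integrand.\<close>

definition bessel_kernel :: "complex \<Rightarrow> real \<Rightarrow> real \<Rightarrow> complex" where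
  "bessel_kernel \<nu> q t = exp (\<nu> * of_real t - of_real (exp t + q * exp (- t)))"

lemma integrable_bessel_kernel:
  assumes "Re \<nu> > 0" "q \<ge> 0"
  shows "integrable lborel (bessel_kernel \<nu> q)"
proof (rule Bochner_Integration.integrable_bound)
  show "integrable lborel (\<lambda>t. exp (\<nu> * of_real t - of_real (1 * exp t)))"
    by (rule Gamma_integral_lborel) (use assms in auto)
  show "bessel_kernel \<nu> q \<in> borel_measurable lborel"
    unfolding bessel_kernel_def[abs_def] by measurable
qed (use assms in \<open>auto simp: bessel_kernel_def\<close>)

text \<open>The cosh in the definition of \<open>besselK\<close> is the even part of an exponential;
  folding the line at 0 turns its half-line integral into one over the whole line.\<close>

lemma integral_even_part_lborel:
  fixes W :: "real \<Rightarrow> complex"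
  assumes W: "integrable lborel W"
  shows "integral {0..} (\<lambda>t. (W t + W (- t)) / 2) = (LINT t|lborel. W t) / 2"
proof -
  have W': "integrable lborel (\<lambda>t. W (- t))"
    using lborel_integrable_real_affine[OF W, of "-1" 0] by simp
  have sW: "set_integrable lborel A W" and sW': "set_integrable lborel A (\<lambda>t. W (- t))" if "A \<in> sets borel" for A
    using W W' that by (auto simp: set_integrable_def intro!: integrable_mult_indicator)
  have "(LINT t|lborel. W t) = (LINT t:({0..} \<union> {..<0})|lborel. W t)"
  proof -
    have "{0..} \<union> {..<0} = (UNIV :: real set)" by auto
    then show ?thesis by (simp add: set_lebesgue_integral_def)
  qed
  also have "\<dots> = (LINT t:{0..}|lborel. W t) + (LINT t:{..<0}|lborel. W t)"
    by (rule set_integral_Un) (use sW in auto)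
  also have "(LINT t:{..<0}|lborel. W t) = (LINT t|lborel. indicator {..<0} (0 + (-1) * t) *\<^sub>R W (0 + (-1) * t))"
    unfolding set_lebesgue_integral_def by (subst lborel_integral_real_affine[of "-1" _ 0]) auto
  also have "\<dots> = (LINT t:{0<..}|lborel. W (- t))"
    unfolding set_lebesgue_integral_def by (intro Bochner_Integration.integral_cong) (auto simp: indicator_def)
  also have "\<dots> = (LINT t:{0..}|lborel. W (- t))"
  proof (rule set_integral_cong_set)
    have "AE t in lborel. t \<noteq> (0::real)" by (rule AE_lborel_singleton)
    then show "AE t in lborel. (t \<in> {0..}) = (t \<in> {0::real<..})" by eventually_elim auto
  qed (use W' in \<open>auto simp: set_borel_measurable_def\<close>)
  also have "(LINT t:{0..}|lborel. W t) + (LINT t:{0..}|lborel. W (- t)) = (LINT t:{0..}|lborel. W t + W (- t))"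
    by (rule set_integral_add(2)[symmetric]) (use sW sW' in auto)
  finally have "(LINT t|lborel. W t) / 2 = (LINT t:{0..}|lborel. (W t + W (- t)) / 2)"
    by simp
  moreover have "set_integrable lborel {0..} (\<lambda>t. (W t + W (- t)) / 2)"
    using set_integral_add(1)[OF sW sW', of "{0..}"] by (simp add: set_integrable_divide)
  ultimately show ?thesis
    by (simp add: set_borel_integral_eq_integral(2))
qed

lemma besselK_eq_integral_lborel:
  assumes \<nu>: "Re \<nu> > 0" and q: "q > 0"
  shows "besselK \<nu> (2 * sqrt q) = of_real q powr (- \<nu> / 2) * (LINT t|lborel. bessel_kernel \<nu> q t) / 2"
proof -
  \<comment> \<open>Translation by L balances the two exponentials: exp t + q exp (-t) becomes 2
    sqrt q cosh t.\<close>
  define L where "L = ln q / 2"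
  have eL: "exp L = sqrt q" "exp (- L) = 1 / sqrt q"
  proof -
    show "exp L = sqrt q"
      using q by (simp add: L_def powr_half_sqrt[symmetric] powr_def)
    then show "exp (- L) = 1 / sqrt q" by (simp only: exp_minus inverse_eq_divide)
  qed
  define W where "W t = exp (\<nu> * of_real t - of_real (2 * sqrt q * cosh t))" for t :: real
  have WK: "W t = exp (- \<nu> * of_real L) * bessel_kernel \<nu> q (L + 1 * t)" for t
  proof -
    have "exp (L + t) + q * exp (- (L + t)) = 2 * sqrt q * cosh t"
    proof -
      have "q * (1 / sqrt q) = sqrt q" using q by (simp add: real_div_sqrt)
      then have "q * exp (- (L + t)) = sqrt q * exp (- t)"
        by (simp only: minus_add_distrib exp_add eL mult.assoc[symmetric])
      then show ?thesis by (simp only: exp_add eL cosh_def) (simp add: algebra_simps)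
    qed
    then show ?thesis
      unfolding W_def bessel_kernel_def by (simp add: algebra_simps flip: exp_add)
  qed
  have W: "integrable lborel W" unfolding WK
    by (intro integrable_mult_right lborel_integrable_real_affine integrable_bessel_kernel) (use \<nu> q in auto)
  have "(LINT t|lborel. bessel_kernel \<nu> q (L + 1 * t)) = (LINT t|lborel. bessel_kernel \<nu> q t)"
    using lborel_integral_real_affine[of 1 "bessel_kernel \<nu> q" L] by simp
  then have int: "(LINT t|lborel. W t) = exp (- \<nu> * of_real L) * (LINT t|lborel. bessel_kernel \<nu> q t)"
    unfolding WK by simp
  have "complex_of_real (exp (- (2 * sqrt q) * cosh t)) * cosh (\<nu> * of_real t) = (W t + W (- t)) / 2" for t
  proof -
    define E where "E = complex_of_real (exp (- (2 * sqrt q) * cosh t))"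
    have "W t = exp (\<nu> * of_real t) * E" "W (- t) = exp (- (\<nu> * of_real t)) * E"
      by (simp_all add: W_def E_def exp_of_real[symmetric] flip: exp_add)
    then show ?thesis unfolding E_def[symmetric] cosh_field_def[of "\<nu> * of_real t"] by (simp add: algebra_simps)
  qed
  then have "besselK \<nu> (2 * sqrt q) = integral {0..} (\<lambda>t. (W t + W (- t)) / 2)"
    unfolding besselK_def by (simp only:)
  also have "\<dots> = (LINT t|lborel. W t) / 2" by (rule integral_even_part_lborel[OF W])
  finally have "besselK \<nu> (2 * sqrt q) = exp (- \<nu> * of_real L) * (LINT t|lborel. bessel_kernel \<nu> q t) / 2"
    unfolding int .
  moreover have "exp (- \<nu> * of_real L) = of_real q powr (- \<nu> / 2)"
    using q by (simp add: powr_def Ln_of_real L_def)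
  ultimately show ?thesis by simp
qed

section \<open>Divisor sums\<close>

text \<open>Bounding exp (-q exp (-t)) by r! / (q exp (-t))^r costs exp (r t), a shift of \<nu> by
  r, and gains q^(-r). As r is free, the decay in q beats every power.\<close>

lemma norm_bessel_kernel_integral_le:
  assumes \<nu>: "Re \<nu> > 0" and q: "q > 0"
  shows "(LINT t|lborel. norm (bessel_kernel \<nu> q t)) \<le> fact r / q ^ r * (LINT t|lborel. norm (bessel_kernel (\<nu> + of_nat r) 0 t))"
proof -
  have "(LINT t|lborel. norm (bessel_kernel \<nu> q t)) \<le> (LINT t|lborel. fact r / q ^ r * norm (bessel_kernel (\<nu> + of_nat r) 0 t))"
  proof (rule integral_mono)
    show "integrable lborel (\<lambda>t. norm (bessel_kernel \<nu> q t))"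
      by (intro integrable_norm integrable_bessel_kernel) (use \<nu> q in auto)
    show "integrable lborel (\<lambda>t. fact r / q ^ r * norm (bessel_kernel (\<nu> + of_nat r) 0 t))"
      by (intro integrable_mult_right integrable_norm integrable_bessel_kernel) (use \<nu> in auto)
    fix t :: real
    have "exp (- (q * exp (- t))) \<le> fact r / (q * exp (- t)) ^ r"
      using q by (intro exp_minus_le_fact_div_power) auto
    also have "\<dots> = fact r / q ^ r * exp (real r * t)"
      by (simp add: power_mult_distrib exp_minus exp_of_nat_mult divide_inverse power_inverse)
    finally have "exp (Re \<nu> * t - exp t) * exp (- (q * exp (- t))) \<le> exp (Re \<nu> * t - exp t) * (fact r / q ^ r * exp (real r * t))"
      by (intro mult_left_mono) auto
    moreover have "norm (bessel_kernel \<nu> q t) = exp (Re \<nu> * t - exp t) * exp (- (q * exp (- t)))"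
      by (simp add: bessel_kernel_def flip: exp_add)
    moreover have "norm (bessel_kernel (\<nu> + of_nat r) 0 t) = exp (Re \<nu> * t - exp t) * exp (real r * t)"
      by (simp add: bessel_kernel_def algebra_simps flip: exp_add)
    ultimately show "norm (bessel_kernel \<nu> q t) \<le> fact r / q ^ r * norm (bessel_kernel (\<nu> + of_nat r) 0 t)"
      by (simp add: mult_ac)
  qed
  then show ?thesis by simp
qed

text \<open>Pairs of positive integers are grouped by their product. All indices are shifted by one,
  hence the -1 in the bijection.\<close>

lemma has_sum_divisor_sums:
  fixes F :: "nat \<Rightarrow> nat \<Rightarrow> real"
  assumes "((\<lambda>(e, d). F (Suc e) (Suc d)) has_sum S) (UNIV \<times> UNIV)"
  shows "((\<lambda>n. \<Sum>d | d dvd Suc n. F (Suc n div d) d) has_sum S) UNIV"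
proof (rule has_sum_SigmaD[where B = "\<lambda>n. {d. d dvd Suc n}" and f = "\<lambda>(n, d). F (Suc n div d) d"])
  have "((\<lambda>(n, d). F (Suc n div d) d) has_sum S) (SIGMA n:UNIV. {d. d dvd Suc n}) \<longleftrightarrow>
    ((\<lambda>(e, d). F (Suc e) (Suc d)) has_sum S) (UNIV \<times> UNIV)"
  proof (rule has_sum_reindex_bij_witness[where i = "\<lambda>(e, d). (Suc e * Suc d - 1, Suc d)" and j = "\<lambda>(n, d). (Suc n div d - 1, d - 1)"])
    fix z :: "nat \<times> nat" assume z: "z \<in> (SIGMA n:UNIV. {d. d dvd Suc n})"
    obtain n d where nd: "z = (n, d)" "d dvd Suc n" using z by auto
    then obtain e where e: "Suc n = d * e" by (auto simp: dvd_def)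
    then have pos: "d > 0" "e > 0" by (metis gr0I mult_is_0 nat.distinct(1))+
    then have div: "Suc n div d = e" using e by simp
    have "e * d - 1 = n" using e by (metis diff_Suc_1 mult.commute)
    then show "(case (case z of (n, d) \<Rightarrow> (Suc n div d - 1, d - 1)) of (e, d) \<Rightarrow> (Suc e * Suc d - 1, Suc d)) = z"
      using pos unfolding nd(1) prod.case div by simp
    show "(case (case z of (n, d) \<Rightarrow> (Suc n div d - 1, d - 1)) of (e, d) \<Rightarrow> F (Suc e) (Suc d)) = (case z of (n, d) \<Rightarrow> F (Suc n div d) d)"
      using pos unfolding nd(1) prod.case div by simp
  next
    fix z :: "nat \<times> nat"
    obtain e d where z: "z = (e, d)" by fastforce
    have prod: "Suc (Suc e * Suc d - 1) = Suc e * Suc d" by simp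
    then have "Suc (Suc e * Suc d - 1) div Suc d = Suc e" by (simp only: nonzero_mult_div_cancel_right nat.distinct not_False_eq_True)
    then show "(case (case z of (e, d) \<Rightarrow> (Suc e * Suc d - 1, Suc d)) of (n, d) \<Rightarrow> (Suc n div d - 1, d - 1)) = z"
      unfolding z prod.case by simp
    have "Suc d dvd Suc (Suc e * Suc d - 1)" unfolding prod by (rule dvd_triv_right)
    then show "(case z of (e, d) \<Rightarrow> (Suc e * Suc d - 1, Suc d)) \<in> (SIGMA n:UNIV. {d. d dvd Suc n})"
      unfolding z prod.case by blast
  qed auto
  with assms show "((\<lambda>(n, d). F (Suc n div d) d) has_sum S) (SIGMA n:UNIV. {d. d dvd Suc n})" by simp
  show "((\<lambda>d. case (n, d) of (n, d) \<Rightarrow> F (Suc n div d) d) has_sum (\<Sum>d | d dvd Suc n. F (Suc n div d) d)) {d. d dvd Suc n}" for n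
    by (rule has_sum_finiteI) (auto intro: finite_divisors_nat)
qed

definition twisted_sigma :: "nat \<Rightarrow> real \<Rightarrow> real \<Rightarrow> nat \<Rightarrow> real" where
  "twisted_sigma k \<theta> \<psi> n = (\<Sum>d | d dvd n. real d ^ k * cos (2 * pi * real d * \<theta>) * cos (2 * pi * real n * \<psi> / real d))"

lemma abs_twisted_sigma_le:
  assumes "n > 0"
  shows "\<bar>twisted_sigma k \<theta> \<psi> n\<bar> \<le> real n ^ (k + 1)"
proof -
  have fin: "finite {d. d dvd n}" using assms by (simp add: finite_divisors_nat)
  have "card {d. d dvd n} \<le> card {1..n}"
    by (rule card_mono) (use assms in \<open>auto dest: dvd_imp_le intro: Suc_leI dvd_pos_nat\<close>)
  then have card: "real (card {d. d dvd n}) \<le> real n" by simp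
  have "\<bar>twisted_sigma k \<theta> \<psi> n\<bar> \<le> (\<Sum>d | d dvd n. \<bar>real d ^ k * cos (2 * pi * real d * \<theta>) * cos (2 * pi * real n * \<psi> / real d)\<bar>)"
    unfolding twisted_sigma_def by (rule sum_abs)
  also have "\<dots> \<le> (\<Sum>d | d dvd n. real n ^ k)"
  proof (rule sum_mono)
    fix d assume "d \<in> {d. d dvd n}"
    then have "d \<le> n" using assms by (auto dest: dvd_imp_le)
    then have "real d ^ k * \<bar>cos (2 * pi * real d * \<theta>)\<bar> * \<bar>cos (2 * pi * real n * \<psi> / real d)\<bar> \<le> real n ^ k * 1 * 1"
      by (intro mult_mono power_mono) auto
    then show "\<bar>real d ^ k * cos (2 * pi * real d * \<theta>) * cos (2 * pi * real n * \<psi> / real d)\<bar> \<le> real n ^ k"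
      by (simp add: abs_mult power_abs)
  qed
  also have "\<dots> = real (card {d. d dvd n}) * real n ^ k" by simp
  also have "\<dots> \<le> real n * real n ^ k" using card by (intro mult_right_mono) auto
  finally show ?thesis by simp
qed

text \<open>The product formula for cosines gives the phases d \<theta> + e \<psi> and d \<theta> -
  e \<psi>, where n = d e; modulo integers the latter is d \<theta> + e (1 - \<psi>).\<close>

lemma has_sum_twisted_sigma:
  assumes y: "y > 0"
  shows "((\<lambda>n. twisted_sigma k \<theta> \<psi> (Suc n) * exp (- y * real (Suc n))) has_sum
    (twisted_lambert k y \<theta> \<psi> + twisted_lambert k y \<theta> (1 - \<psi>)) / 2) UNIV"
proof -
  define F where "F e d = real d ^ k * exp (- y * real e * real d) * (cos (2 * pi * (real d * \<theta>)) * cos (2 * pi * (real e * \<psi>)))" for e d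
  have cc: "cos (2 * pi * (real d * \<theta>)) * cos (2 * pi * (real e * \<psi>)) =
     (cos (2 * pi * (real d * \<theta> + real e * \<psi>)) + cos (2 * pi * (real d * \<theta> + real e * (1 - \<psi>)))) * (1 / 2)" for d e
  proof -
    have "cos (2 * pi * (real d * \<theta> + real e * (1 - \<psi>))) = cos ((2 * pi * (real d * \<theta>) - 2 * pi * (real e * \<psi>)) + 2 * pi * real e)"
      by (simp add: algebra_simps)
    also have "\<dots> = cos (2 * pi * (real d * \<theta>) - 2 * pi * (real e * \<psi>))"
      using cos_2npi[of e] sin_2npi[of e] by (simp add: cos_add mult_ac)
    finally show ?thesis
      unfolding distrib_left cos_times_cos by simp
  qed
  have Fsplit: "F e d = (real d ^ k * exp (- y * real e * real d) * cos (2 * pi * (real d * \<theta> + real e * \<psi>))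
     + real d ^ k * exp (- y * real e * real d) * cos (2 * pi * (real d * \<theta> + real e * (1 - \<psi>)))) * (1 / 2)" for e d
    unfolding F_def cc by (simp only: ring_distribs mult.assoc)
  have "((\<lambda>z. ((case z of (e, d) \<Rightarrow> real (Suc d) ^ k * exp (- y * real (Suc e) * real (Suc d)) * cos (2 * pi * (real (Suc d) * \<theta> + real (Suc e) * \<psi>)))
     + (case z of (e, d) \<Rightarrow> real (Suc d) ^ k * exp (- y * real (Suc e) * real (Suc d)) * cos (2 * pi * (real (Suc d) * \<theta> + real (Suc e) * (1 - \<psi>))))) * (1 / 2))
    has_sum (twisted_lambert k y \<theta> \<psi> + twisted_lambert k y \<theta> (1 - \<psi>)) * (1 / 2)) (UNIV \<times> UNIV)"
    by (intro has_sum_cmult_left has_sum_add has_sum_twisted_lambert(2) y)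
  then have "((\<lambda>(e, d). F (Suc e) (Suc d)) has_sum (twisted_lambert k y \<theta> \<psi> + twisted_lambert k y \<theta> (1 - \<psi>)) * (1 / 2)) (UNIV \<times> UNIV)"
    unfolding Fsplit by (simp only: case_prod_unfold)
  from has_sum_divisor_sums[OF this]
  have *: "((\<lambda>n. \<Sum>d | d dvd Suc n. F (Suc n div d) d) has_sum (twisted_lambert k y \<theta> \<psi> + twisted_lambert k y \<theta> (1 - \<psi>)) * (1 / 2)) UNIV" .
  have "(\<Sum>d | d dvd Suc n. F (Suc n div d) d) = twisted_sigma k \<theta> \<psi> (Suc n) * exp (- y * real (Suc n))" for n
    unfolding twisted_sigma_def sum_distrib_right
  proof (rule sum.cong)
    fix d assume "d \<in> {d. d dvd Suc n}"
    then have "real (Suc n div d) * real d = real (Suc n)" "real (Suc n div d) = real (Suc n) / real d"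
      by (auto simp: real_of_nat_div dest: dvd_imp_le simp flip: of_nat_mult intro!: Nat.gr0I)
    then show "F (Suc n div d) d = real d ^ k * cos (2 * pi * real d * \<theta>) * cos (2 * pi * real (Suc n) * \<psi> / real d) * exp (- y * real (Suc n))"
      by (simp only: F_def mult.assoc) (simp add: mult_ac)
  qed simp
  with * show ?thesis by simp
qed

section \<open>Termwise integration\<close>

text \<open>Each exponential of the Lambert series merges with the kernel into a Gamma integral.
  Absolute convergence needs exponents above 1 in both variables, Re s in m and Re s - k in
  n.\<close>

lemma integral_lambert:
  fixes s :: complex and b \<alpha> \<phi> :: real
  assumes s: "Re s > real k + 1" and b: "b > 0" and \<alpha>: "0 < \<alpha>" "\<alpha> < 1" and \<phi>: "0 < \<phi>" "\<phi> < 1"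
  shows "integrable lborel (\<lambda>t. bessel_kernel s 0 t * of_real (lambert k (b * exp t) \<alpha> \<phi>))"
    and "((\<lambda>(m, n). Gamma s * (of_real ((real n + \<phi>) ^ k) / of_real (b * (real m + \<alpha>) * (real n + \<phi>) + 1) powr s)) has_sum
      (LINT t|lborel. bessel_kernel s 0 t * of_real (lambert k (b * exp t) \<alpha> \<phi>))) (UNIV \<times> UNIV)"
proof -
  have s0: "Re s > 0" using s by simp
  define N where "N z = real (snd z) + \<phi>" for z :: "nat \<times> nat"
  define M where "M z = real (fst z) + \<alpha>" for z :: "nat \<times> nat"
  \<comment> \<open>The 1 comes from exp t in the kernel, the product from the Lambert exponent b
    exp t.\<close>
  define l where "l z = b * M z * N z + 1" for z
  have N: "N z > 0" "\<phi> * (1 + real (snd z)) \<le> N z" and M: "M z > 0" "\<alpha> * (1 + real (fst z)) \<le> M z" for z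
    using \<alpha> \<phi> by (auto simp: N_def M_def distrib_left mult_left_le_one_le)
  have l: "l z > 0" for z using N[of z] M[of z] b by (simp add: l_def add_pos_pos)
  define f where "f z t = of_real (N z ^ k) * exp (s * of_real t - of_real (l z * exp t))" for z t
  have fint: "integrable lborel (f z)" and fval: "(LINT t|lborel. f z t) = Gamma s * (of_real (N z ^ k) / of_real (l z) powr s)" for z
    unfolding f_def using Gamma_integral_lborel[OF s0 l] by (auto intro: integrable_mult_right)
  have fnorm: "norm (f z t) = N z ^ k * exp (Re s * t - l z * exp t)" for z t
    using N[of z] by (simp add: f_def norm_mult norm_power)
  have fsplit: "f z t = bessel_kernel s 0 t * of_real (N z ^ k * exp (- (b * exp t) * M z * N z))" for z t
    by (simp add: f_def bessel_kernel_def l_def exp_of_real[symmetric] algebra_simps flip: exp_add)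
  have L: "((\<lambda>z. N z ^ k * exp (- (b * exp t) * M z * N z)) has_sum lambert k (b * exp t) \<alpha> \<phi>) UNIV" for t
    using has_sum_lambert[of "b * exp t" \<alpha> \<phi> k] b \<alpha> \<phi> by (simp add: case_prod_unfold N_def M_def)
  have hs: "((\<lambda>z. f z t) has_sum bessel_kernel s 0 t * of_real (lambert k (b * exp t) \<alpha> \<phi>)) UNIV" for t
    unfolding fsplit by (intro has_sum_cmult_right has_sum_of_real L)
  have hsn: "(\<lambda>z. norm (f z t)) summable_on UNIV" for t
    unfolding fsplit norm_mult norm_of_real
    by (intro summable_on_cmult_right) (use has_sum_imp_summable[OF L[of t]] N in \<open>simp add: abs_mult less_imp_le\<close>)
  \<comment> \<open>Integration of series works along sequences, so the pairs are enumerated; the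
    resulting value is later matched with the unordered sum.\<close>
  have bij: "bij_betw prod_decode UNIV UNIV" by (rule bij_prod_decode)
  define J where "J z = (LINT t|lborel. norm (f z t))" for z
  have J: "J z = N z ^ k * (Re (Gamma (of_real (Re s))) / l z powr Re s)" for z
  proof -
    have "(LINT t|lborel. complex_of_real (exp (Re s * t - l z * exp t))) = Gamma (of_real (Re s)) / of_real (l z) powr of_real (Re s)"
      using Gamma_integral_lborel(2)[of "of_real (Re s)" "l z"] s0 l by (simp flip: exp_of_real)
    then have "complex_of_real (LINT t|lborel. exp (Re s * t - l z * exp t)) = Gamma (of_real (Re s)) / of_real (l z) powr of_real (Re s)"
      by simp
    also have "\<dots> = Gamma (of_real (Re s)) / of_real (l z powr Re s)"
      using l[of z] by (simp add: powr_of_real)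
    finally have "(LINT t|lborel. exp (Re s * t - l z * exp t)) = Re (Gamma (of_real (Re s)) / of_real (l z powr Re s))"
      by (metis Re_complex_of_real)
    then show ?thesis unfolding J_def fnorm by simp
  qed
  have Jnn: "J z \<ge> 0" for z by (simp add: J_def)
  have Jsum: "J summable_on UNIV"
  proof -
    \<comment> \<open>Dropping the 1 in \<open>l z\<close> separates the variables; the powers of
      \<alpha> and \<phi> come from the linear lower bounds for \<open>M z\<close> and
      \<open>N z\<close>.\<close>
    define c where "c = \<bar>Re (Gamma (of_real (Re s)))\<bar> * b powr (- Re s) * \<alpha> powr (- Re s) * \<phi> powr (real k - Re s)"
    have "(\<lambda>(m, n). (c * (1 + real m) powr (- Re s)) * (1 + real n) powr (- (Re s - real k))) summable_on UNIV \<times> UNIV"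
      by (intro summable_on_times_product summable_on_cmult_right summable_on_nat_powr) (use s in \<open>auto simp: c_def\<close>)
    then have "(\<lambda>z. (c * (1 + real (fst z)) powr (- Re s)) * (1 + real (snd z)) powr (- (Re s - real k))) summable_on UNIV"
      by (simp add: case_prod_unfold)
    then show ?thesis
    proof (rule summable_on_comparison_test)
      fix z
      have "J z \<le> N z ^ k * (\<bar>Re (Gamma (of_real (Re s)))\<bar> * l z powr (- Re s))"
        unfolding J using N[of z] l[of z] by (intro mult_left_mono) (auto simp: powr_minus divide_inverse intro!: mult_right_mono)
      also have "\<dots> \<le> N z ^ k * (\<bar>Re (Gamma (of_real (Re s)))\<bar> * (b * M z * N z) powr (- Re s))"
        using N[of z] M[of z] b s0 by (intro mult_left_mono powr_mono2') (auto simp: l_def)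
      also have "\<dots> = \<bar>Re (Gamma (of_real (Re s)))\<bar> * b powr (- Re s) * M z powr (- Re s) * N z powr (real k - Re s)"
        using N[of z] M[of z] b by (simp add: powr_mult powr_diff powr_minus powr_realpow field_simps)
      also have "\<dots> \<le> \<bar>Re (Gamma (of_real (Re s)))\<bar> * b powr (- Re s) * (\<alpha> * (1 + real (fst z))) powr (- Re s) * (\<phi> * (1 + real (snd z))) powr (real k - Re s)"
        using N[of z] M[of z] s \<alpha> \<phi> b by (intro mult_mono powr_mono2' mult_nonneg_nonneg) (auto intro!: mult_pos_pos)
      also have "\<dots> = (c * (1 + real (fst z)) powr (- Re s)) * (1 + real (snd z)) powr (- (Re s - real k))"
        using \<alpha> \<phi> by (simp add: c_def powr_mult)
      finally show "J z \<le> (c * (1 + real (fst z)) powr (- Re s)) * (1 + real (snd z)) powr (- (Re s - real k))" .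
    qed (rule Jnn)
  qed
  have tonat: "(\<lambda>i. g (prod_decode i)) sums S" if "(g has_sum S) UNIV" for g :: "nat \<times> nat \<Rightarrow> complex" and S
    using that has_sum_reindex_bij_betw[OF bij, of g S] by (intro has_sum_imp_sums) simp
  have tonat': "summable (\<lambda>i. g (prod_decode i))" if "g summable_on UNIV" for g :: "nat \<times> nat \<Rightarrow> real"
    using that summable_on_reindex_bij_betw[OF bij, of g] by (intro summable_on_imp_summable) simp
  have lim: "(\<Sum>i. f (prod_decode i) t) = bessel_kernel s 0 t * of_real (lambert k (b * exp t) \<alpha> \<phi>)" for t
    using tonat[OF hs[of t]] by (simp add: sums_iff)
  have AE: "AE t in lborel. summable (\<lambda>i. norm (f (prod_decode i) t))"
    by (intro AE_I2 tonat' hsn)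
  have sJ: "summable (\<lambda>i. LINT t|lborel. norm (f (prod_decode i) t))"
    using tonat'[OF Jsum] by (simp add: J_def)
  show "integrable lborel (\<lambda>t. bessel_kernel s 0 t * of_real (lambert k (b * exp t) \<alpha> \<phi>))"
    using integrable_suminf[OF fint AE sJ] unfolding lim .
  have sums: "(\<lambda>i. LINT t|lborel. f (prod_decode i) t) sums (LINT t|lborel. bessel_kernel s 0 t * of_real (lambert k (b * exp t) \<alpha> \<phi>))"
    using sums_integral[OF fint AE sJ] unfolding lim .
  have "(\<lambda>z. norm (LINT t|lborel. f z t)) summable_on UNIV"
    by (rule Infinite_Sum.abs_summable_on_comparison_test'[OF Jsum]) (simp add: J_def)
  then have "(\<lambda>z. LINT t|lborel. f z t) summable_on UNIV" by (rule abs_summable_summable)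
  then have "((\<lambda>z. LINT t|lborel. f z t) has_sum (\<Sum>\<^sub>\<infinity>z. LINT t|lborel. f z t)) UNIV" by (rule has_sum_infsum)
  moreover from tonat[OF this] sums have "(\<Sum>\<^sub>\<infinity>z. LINT t|lborel. f z t) = (LINT t|lborel. bessel_kernel s 0 t * of_real (lambert k (b * exp t) \<alpha> \<phi>))"
    using sums_unique2 by blast
  ultimately have "((\<lambda>z. LINT t|lborel. f z t) has_sum (LINT t|lborel. bessel_kernel s 0 t * of_real (lambert k (b * exp t) \<alpha> \<phi>))) UNIV"
    by simp
  then show "((\<lambda>(m, n). Gamma s * (of_real ((real n + \<phi>) ^ k) / of_real (b * (real m + \<alpha>) * (real n + \<phi>) + 1) powr s)) has_sum
      (LINT t|lborel. bessel_kernel s 0 t * of_real (lambert k (b * exp t) \<alpha> \<phi>))) (UNIV \<times> UNIV)"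
    unfolding fval by (simp add: case_prod_unfold l_def N_def M_def)
qed

lemma bessel_sum_eq_integral:
  fixes X :: real
  assumes \<nu>: "Re \<nu> > 0" and X: "X > 0"
  shows "(\<lambda>n. of_real (twisted_sigma k \<theta> \<psi> (Suc n)) * (LINT t|lborel. bessel_kernel \<nu> (X * real (Suc n)) t)) sums
    (LINT t|lborel. bessel_kernel \<nu> 0 t * of_real ((twisted_lambert k (X * exp (- t)) \<theta> \<psi> + twisted_lambert k (X * exp (- t)) \<theta> (1 - \<psi>)) / 2))"
proof -
  define \<sigma> where "\<sigma> n = twisted_sigma k \<theta> \<psi> (Suc n)" for n
  define f where "f n t = of_real (\<sigma> n) * bessel_kernel \<nu> (X * real (Suc n)) t" for n t
  \<comment> \<open>The part of the kernel depending on n is the exponential of a Lambert series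
    with parameter y = X exp (-t).\<close>
  have fsplit: "f n t = bessel_kernel \<nu> 0 t * of_real (\<sigma> n * exp (- (X * exp (- t)) * real (Suc n)))" for n t
    by (simp add: f_def bessel_kernel_def exp_of_real[symmetric] algebra_simps flip: exp_add)
  have hs: "((\<lambda>n. \<sigma> n * exp (- (X * exp (- t)) * real (Suc n))) has_sum
      ((twisted_lambert k (X * exp (- t)) \<theta> \<psi> + twisted_lambert k (X * exp (- t)) \<theta> (1 - \<psi>)) / 2)) UNIV" for t
    unfolding \<sigma>_def by (rule has_sum_twisted_sigma) (use X in simp)
  have lim: "(\<Sum>n. f n t) = bessel_kernel \<nu> 0 t * of_real ((twisted_lambert k (X * exp (- t)) \<theta> \<psi> + twisted_lambert k (X * exp (- t)) \<theta> (1 - \<psi>)) / 2)" for t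
    using has_sum_imp_sums[OF has_sum_cmult_right[OF has_sum_of_real[OF hs[of t]], of "bessel_kernel \<nu> 0 t"]]
    unfolding fsplit by (simp only: sums_iff)
  have abs: "(\<lambda>n. \<bar>\<sigma> n * exp (- (X * exp (- t)) * real (Suc n))\<bar>) summable_on UNIV" for t
    using has_sum_imp_summable[OF hs[of t]] summable_on_iff_abs_summable_on_real by fastforce
  have "summable (\<lambda>n. norm (f n t))" for t
  proof -
    have "(\<lambda>n. norm (f n t)) summable_on UNIV"
      unfolding fsplit norm_mult[of "bessel_kernel \<nu> 0 t"] norm_of_real by (intro summable_on_cmult_right abs)
    then show ?thesis by (rule summable_on_imp_summable)
  qed
  then have AE: "AE t in lborel. summable (\<lambda>n. norm (f n t))" by (intro AE_I2)
  have fint: "integrable lborel (f n)" for n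
    unfolding f_def by (intro integrable_mult_right integrable_bessel_kernel) (use \<nu> X in auto)
  have sI: "summable (\<lambda>n. LINT t|lborel. norm (f n t))"
  proof (rule summable_comparison_test')
    \<comment> \<open>The divisor sum grows at most like n^(k+1), so r = k + 3 leaves an inverse
      square.\<close>
    define c where "c = fact (k + 3) / X ^ (k + 3) * (LINT t|lborel. norm (bessel_kernel (\<nu> + of_nat (k + 3)) 0 t))"
    show "summable (\<lambda>n. c * (1 / real (Suc n) ^ 2))"
      by (intro summable_mult) (subst summable_Suc_iff, rule inverse_power_summable[of 2, unfolded inverse_eq_divide], simp)
    fix n :: nat
    have "(LINT t|lborel. norm (f n t)) = \<bar>\<sigma> n\<bar> * (LINT t|lborel. norm (bessel_kernel \<nu> (X * real (Suc n)) t))"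
      by (simp add: f_def norm_mult)
    also have "\<dots> \<le> real (Suc n) ^ (k + 1) * (fact (k + 3) / (X * real (Suc n)) ^ (k + 3) * (LINT t|lborel. norm (bessel_kernel (\<nu> + of_nat (k + 3)) 0 t)))"
      unfolding \<sigma>_def by (intro mult_mono abs_twisted_sigma_le norm_bessel_kernel_integral_le) (use \<nu> X in auto)
    also have "\<dots> = c * (1 / real (Suc n) ^ 2)"
    proof -
      define Y where "Y = real (Suc n)"
      have "k + 3 = (k + 1) + 2" by simp
      then have "Y ^ (k + 3) = Y ^ (k + 1) * Y ^ 2" by (metis power_add)
      moreover have "Y > 0" by (simp add: Y_def)
      ultimately show ?thesis unfolding c_def Y_def[symmetric] power_mult_distrib by (simp del: power_Suc)
    qed
    finally show "norm (LINT t|lborel. norm (f n t)) \<le> c * (1 / real (Suc n) ^ 2)" by simp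
  qed
  have "(\<lambda>n. LINT t|lborel. f n t) sums (LINT t|lborel. (\<Sum>n. f n t))"
    by (rule sums_integral[OF fint AE sI])
  then show ?thesis unfolding lim by (simp add: f_def \<sigma>_def)
qed

section \<open>Assembly of the four dual series and comparison of constants\<close>

theorem theorem2p13:
  fixes a x \<theta> \<psi> :: real and k :: nat and \<nu> :: complex
  assumes "a > 0" "x > 0" "0 < \<theta>" "\<theta> < 1" "0 < \<psi>" "\<psi> < 1"
    and "odd k" "k \<ge> 1" "Re \<nu> > 0"
  shows "complex_of_real (a^2 * x / 4) powr (\<nu> / 2 + of_nat k + 1) *
      (\<Sum>n. of_nat (Suc n) powr (\<nu> / 2) * besselK \<nu> (a * sqrt (real (Suc n) * x)) *
         (\<Sum>d | d dvd Suc n. complex_of_real (real d ^ k * cos (2 * pi * real d * \<theta>)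
                                  * cos (2 * pi * real (Suc n) * \<psi> / real d))))
    = complex_of_real ((-1) ^ ((k - 1) div 2) * a ^ (2 * k + 2) * fact k
                        / (2 ^ (2 * k + 4) * (2 * pi) ^ (k + 1)))
        * Gamma \<nu>
        * complex_of_real ((hurwitz_zeta (real k + 1) \<theta> + hurwitz_zeta (real k + 1) (1 - \<theta>)) * x ^ (k + 1))
      + complex_of_real ((-1) ^ ((k + 1) div 2) / 8 * (2 * pi) ^ (k + 1))
        * Gamma (\<nu> + of_nat k + 1)
        * (\<Sum>\<^sub>\<infinity>(m, n) \<in> (UNIV :: (nat \<times> nat) set).
             let s = \<nu> + of_nat k + 1; c = 16 * pi^2 / a^2 / x in
               complex_of_real ((real n + \<psi>) ^ k)
                 / complex_of_real (c * (real m + \<theta>) * (real n + \<psi>) + 1) powr s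
             + complex_of_real ((real n + 1 - \<psi>) ^ k)
                 / complex_of_real (c * (real m + \<theta>) * (real n + 1 - \<psi>) + 1) powr s
             + complex_of_real ((real n + \<psi>) ^ k)
                 / complex_of_real (c * (real m + 1 - \<theta>) * (real n + \<psi>) + 1) powr s
             + complex_of_real ((real n + 1 - \<psi>) ^ k)
                 / complex_of_real (c * (real m + 1 - \<theta>) * (real n + 1 - \<psi>) + 1) powr s)"
proof -
  \<comment> \<open>Chosen so that a sqrt (n x) = 2 sqrt (X n), the argument in the Bessel
    integral.\<close>
  define X where "X = a^2 * x / 4"
  define s where "s = \<nu> + of_nat k + 1"
  define b where "b = 4 * pi^2 / X"
  define sg :: real where "sg = (-1) ^ ((k + 1) div 2)"
  define Z where "Z = hurwitz_zeta (real k + 1) \<theta> + hurwitz_zeta (real k + 1) (1 - \<theta>)"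
  define A where "A = - (fact k * (sg / (2 * pi) ^ (k + 1) * Z)) / 2"
  define B where "B = sg * (2 * pi / X) ^ (k + 1) / 4"
  define K where "K \<alpha> \<phi> t = bessel_kernel s 0 t * of_real (lambert k (b * exp t) \<alpha> \<phi>)" for \<alpha> \<phi> t
  define T where "T \<alpha> \<phi> = (\<lambda>(m, n). of_real ((real n + \<phi>) ^ k) / of_real (b * (real m + \<alpha>) * (real n + \<phi>) + 1) powr s)" for \<alpha> \<phi>
  have X: "X > 0" using assms by (simp add: X_def)
  have b: "b > 0" using X by (simp add: b_def)
  have s: "Re s > real k + 1" using assms by (simp add: s_def)
  \<comment> \<open>At y = X exp (-t) the dual parameter 4 pi^2 / y is b exp t, and y^(-(k+1))
    supplies exp ((k+1) t). The 2 before B disappears when the series at \<psi> and 1 - \<psi> are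
    averaged.\<close>
  have tw: "twisted_lambert k (X * exp (- t)) \<theta> \<phi> = A + 2 * B * exp (real (k + 1) * t)
       * (lambert k (b * exp t) \<theta> \<phi> + lambert k (b * exp t) (1 - \<theta>) (1 - \<phi>))" if "0 < \<phi>" "\<phi> < 1" for \<phi> t
  proof -
    have y: "X * exp (- t) > 0" using X by simp
    have 1: "4 * pi^2 / (X * exp (- t)) = b * exp t" by (simp add: b_def exp_minus field_simps)
    have 2: "(2 * pi / (X * exp (- t))) ^ (k + 1) = (2 * pi / X) ^ (k + 1) * exp (real (k + 1) * t)"
    proof -
      have "2 * pi / (X * exp (- t)) = 2 * pi / X * exp t" by (simp add: exp_minus field_simps)
      then show ?thesis by (simp only: power_mult_distrib exp_of_nat_mult)
    qed
    have "w = - f / 2 + 2 * (sg * q / 4) * e * l" if "2 * w = - f + sg * (q * e) * l" for w f q e l :: real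
      using that by (simp add: field_simps)
    then show ?thesis
      using twisted_lambert_transformation[OF assms(7,8,3,4) that y]
      unfolding 1 2 sg_def[symmetric] Z_def[symmetric] A_def B_def by blast
  qed
  have integrand: "bessel_kernel \<nu> 0 t * of_real ((twisted_lambert k (X * exp (- t)) \<theta> \<psi> + twisted_lambert k (X * exp (- t)) \<theta> (1 - \<psi>)) / 2)
      = of_real A * bessel_kernel \<nu> 0 t + of_real B * (K \<theta> \<psi> t + K \<theta> (1 - \<psi>) t + K (1 - \<theta>) \<psi> t + K (1 - \<theta>) (1 - \<psi>) t)" for t
  proof -
    have "bessel_kernel s 0 t = bessel_kernel \<nu> 0 t * of_real (exp (real (k + 1) * t))"
      by (simp add: bessel_kernel_def s_def exp_of_real[symmetric] algebra_simps flip: exp_add)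
    moreover have "(twisted_lambert k (X * exp (- t)) \<theta> \<psi> + twisted_lambert k (X * exp (- t)) \<theta> (1 - \<psi>)) / 2
      = A + B * exp (real (k + 1) * t) * (lambert k (b * exp t) \<theta> \<psi> + lambert k (b * exp t) \<theta> (1 - \<psi>)
          + lambert k (b * exp t) (1 - \<theta>) \<psi> + lambert k (b * exp t) (1 - \<theta>) (1 - \<psi>))"
      unfolding tw[OF assms(5,6)] using tw[of "1 - \<psi>" t] assms(5,6) by (simp add: algebra_simps)
    ultimately show ?thesis unfolding K_def by (simp only: of_real_add of_real_mult) (simp add: algebra_simps)
  qed
  have Kint: "integrable lborel (K \<alpha> \<phi>)"
    and Ksum: "((\<lambda>z. Gamma s * T \<alpha> \<phi> z) has_sum (LINT t|lborel. K \<alpha> \<phi> t)) UNIV"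
    if "0 < \<alpha>" "\<alpha> < 1" "0 < \<phi>" "\<phi> < 1" for \<alpha> \<phi>
    using integral_lambert[OF s b that] unfolding K_def[abs_def] T_def by (simp_all add: case_prod_unfold)
  have par: "0 < 1 - \<theta>" "1 - \<theta> < 1" "0 < 1 - \<psi>" "1 - \<psi> < 1" using assms by auto
  note K4 = Kint[OF assms(3-6)] Kint[OF assms(3,4) par(3,4)] Kint[OF par(1,2) assms(5,6)] Kint[OF par]
  note S4 = Ksum[OF assms(3-6)] Ksum[OF assms(3,4) par(3,4)] Ksum[OF par(1,2) assms(5,6)] Ksum[OF par]
  define D where "D = (\<Sum>\<^sub>\<infinity>z. T \<theta> \<psi> z + T \<theta> (1 - \<psi>) z + T (1 - \<theta>) \<psi> z + T (1 - \<theta>) (1 - \<psi>) z)"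
  have "((\<lambda>z. Gamma s * (T \<theta> \<psi> z + T \<theta> (1 - \<psi>) z + T (1 - \<theta>) \<psi> z + T (1 - \<theta>) (1 - \<psi>) z)) has_sum
      ((LINT t|lborel. K \<theta> \<psi> t) + (LINT t|lborel. K \<theta> (1 - \<psi>) t) + (LINT t|lborel. K (1 - \<theta>) \<psi> t) + (LINT t|lborel. K (1 - \<theta>) (1 - \<psi>) t))) UNIV"
    unfolding distrib_left by (intro has_sum_add S4)
  then have D: "(LINT t|lborel. K \<theta> \<psi> t) + (LINT t|lborel. K \<theta> (1 - \<psi>) t) + (LINT t|lborel. K (1 - \<theta>) \<psi> t) + (LINT t|lborel. K (1 - \<theta>) (1 - \<psi>) t)
     = Gamma s * D"
    unfolding D_def infsum_cmult_right'[symmetric] by (rule infsumI[symmetric])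
  have I0: "integrable lborel (bessel_kernel \<nu> 0)" "(LINT t|lborel. bessel_kernel \<nu> 0 t) = Gamma \<nu>"
    using Gamma_integral_lborel[OF assms(9), of 1] by (simp_all add: bessel_kernel_def[abs_def])
  have "(LINT t|lborel. bessel_kernel \<nu> 0 t * of_real ((twisted_lambert k (X * exp (- t)) \<theta> \<psi> + twisted_lambert k (X * exp (- t)) \<theta> (1 - \<psi>)) / 2))
     = of_real A * Gamma \<nu> + of_real B * (Gamma s * D)"
    unfolding integrand D[symmetric] I0(2)[symmetric] using K4 I0(1) by simp
  with bessel_sum_eq_integral[OF assms(9) X, of k \<theta> \<psi>]
  have sums: "(\<lambda>n. of_real (twisted_sigma k \<theta> \<psi> (Suc n)) * (LINT t|lborel. bessel_kernel \<nu> (X * real (Suc n)) t)) sums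
     (of_real A * Gamma \<nu> + of_real B * (Gamma s * D))" by (simp only:)

  have summand: "of_nat (Suc n) powr (\<nu> / 2) * besselK \<nu> (a * sqrt (real (Suc n) * x)) *
         (\<Sum>d | d dvd Suc n. complex_of_real (real d ^ k * cos (2 * pi * real d * \<theta>) * cos (2 * pi * real (Suc n) * \<psi> / real d)))
     = of_real X powr (- \<nu> / 2) / 2 * (of_real (twisted_sigma k \<theta> \<psi> (Suc n)) * (LINT t|lborel. bessel_kernel \<nu> (X * real (Suc n)) t))" for n
  proof -
    have "a * sqrt (real (Suc n) * x) = 2 * sqrt (X * real (Suc n))"
    proof -
      have "X * real (Suc n) = (a / 2)^2 * (real (Suc n) * x)" by (simp add: X_def power2_eq_square)
      then show ?thesis using assms(1) by (simp add: real_sqrt_mult)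
    qed
    moreover have "X * real (Suc n) > 0" using X by simp
    ultimately have K: "besselK \<nu> (a * sqrt (real (Suc n) * x)) =
        of_real (X * real (Suc n)) powr (- \<nu> / 2) * (LINT t|lborel. bessel_kernel \<nu> (X * real (Suc n)) t) / 2"
      using besselK_eq_integral_lborel[OF assms(9)] by simp
    have "of_real (X * real (Suc n)) powr (- \<nu> / 2) = of_real X powr (- \<nu> / 2) * of_nat (Suc n) powr (- \<nu> / 2)"
      using X powr_times_real[of "of_real X" "of_nat (Suc n)" "- \<nu> / 2"] by simp
    moreover have "of_nat (Suc n) powr (\<nu> / 2) * of_nat (Suc n) powr (- \<nu> / 2) = (1 :: complex)"
      by (simp flip: powr_add del: of_nat_Suc)
    ultimately have P: "of_nat (Suc n) powr (\<nu> / 2) * of_real (X * real (Suc n)) powr (- \<nu> / 2) = of_real X powr (- \<nu> / 2)"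
      by (simp only: mult.left_commute mult_1_right)
    have "(\<Sum>d | d dvd Suc n. complex_of_real (real d ^ k * cos (2 * pi * real d * \<theta>) * cos (2 * pi * real (Suc n) * \<psi> / real d)))
      = of_real (twisted_sigma k \<theta> \<psi> (Suc n))" by (simp add: twisted_sigma_def)
    then show ?thesis unfolding K P[symmetric] by simp
  qed
  have lhs: "complex_of_real X powr (\<nu> / 2 + of_nat k + 1) *
      (\<Sum>n. of_nat (Suc n) powr (\<nu> / 2) * besselK \<nu> (a * sqrt (real (Suc n) * x)) *
         (\<Sum>d | d dvd Suc n. complex_of_real (real d ^ k * cos (2 * pi * real d * \<theta>) * cos (2 * pi * real (Suc n) * \<psi> / real d))))
      = of_real (X ^ (k + 1) / 2) * (of_real A * Gamma \<nu> + of_real B * (Gamma s * D))"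
  proof -
    \<comment> \<open>The Bessel integral contributes X^(-\<nu>/2) / 2, so just X^(k+1) / 2
      survives; it also cancels the power of X in B.\<close>
    have "complex_of_real X powr (\<nu> / 2 + of_nat k + 1) * of_real X powr (- \<nu> / 2) = of_real X powr of_nat (k + 1)"
      unfolding powr_add[symmetric] by (simp add: add.commute)
    also have "\<dots> = of_real (X ^ (k + 1))"
      unfolding powr_nat using X by simp
    finally have P: "complex_of_real X powr (\<nu> / 2 + of_nat k + 1) * of_real X powr (- \<nu> / 2) = of_real (X ^ (k + 1))" .
    have assoc: "p * (q / 2 * V) = p * q / 2 * V" for p q V :: complex by simp
    show ?thesis
      unfolding summand sums_unique[OF sums_mult[OF sums], symmetric] assoc P by simp
  qed
  have cA: "X ^ (k + 1) / 2 * A = (-1) ^ ((k - 1) div 2) * a ^ (2 * k + 2) * fact k / (2 ^ (2 * k + 4) * (2 * pi) ^ (k + 1)) * (Z * x ^ (k + 1))"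
  proof -
    \<comment> \<open>The sign exponents of the two terms differ by one, which absorbs the minus
      sign in A.\<close>
    have "(k + 1) div 2 = Suc ((k - 1) div 2)" using assms(7,8) by (auto elim!: oddE)
    then have sg: "sg = - ((-1) ^ ((k - 1) div 2))" by (simp add: sg_def)
    have "X ^ (k + 1) = a ^ (2 * k + 2) * x ^ (k + 1) / 2 ^ (2 * k + 2)"
    proof -
      have e: "2 * k + 2 = 2 * (k + 1)" by simp
      have "(a ^ 2) ^ (k + 1) = a ^ (2 * k + 2)" "(4::real) ^ (k + 1) = 2 ^ (2 * k + 2)"
        unfolding e power_mult by simp_all
      then show ?thesis by (simp only: X_def power_divide power_mult_distrib)
    qed
    moreover have "(2::real) ^ (2 * k + 4) = 4 * 2 ^ (2 * k + 2)" by (simp add: power_add)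
    ultimately show ?thesis unfolding A_def sg by (simp del: power_Suc add: mult_ac)
  qed
  have cB: "X ^ (k + 1) / 2 * B = sg / 8 * (2 * pi) ^ (k + 1)"
    using X by (simp add: B_def power_divide del: power_Suc)
  have "b = 16 * pi^2 / a^2 / x" by (simp add: b_def X_def)
  then have D_eq: "D = (\<Sum>\<^sub>\<infinity>(m, n) \<in> (UNIV :: (nat \<times> nat) set).
             let s = \<nu> + of_nat k + 1; c = 16 * pi^2 / a^2 / x in
               complex_of_real ((real n + \<psi>) ^ k)
                 / complex_of_real (c * (real m + \<theta>) * (real n + \<psi>) + 1) powr s
             + complex_of_real ((real n + 1 - \<psi>) ^ k)
                 / complex_of_real (c * (real m + \<theta>) * (real n + 1 - \<psi>) + 1) powr s
             + complex_of_real ((real n + \<psi>) ^ k)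
                 / complex_of_real (c * (real m + 1 - \<theta>) * (real n + \<psi>) + 1) powr s
             + complex_of_real ((real n + 1 - \<psi>) ^ k)
                 / complex_of_real (c * (real m + 1 - \<theta>) * (real n + 1 - \<psi>) + 1) powr s)"
    unfolding D_def T_def Let_def by (simp only: case_prod_unfold add_diff_eq s_def)
  have "of_real (X ^ (k + 1) / 2) * (of_real A * Gamma \<nu> + of_real B * (Gamma s * D))
    = of_real (X ^ (k + 1) / 2 * A) * Gamma \<nu> + of_real (X ^ (k + 1) / 2 * B) * Gamma s * D"
    by (simp only: of_real_mult distrib_left mult.assoc)
  note final = this[unfolded cA cB]
  show ?thesis
    unfolding X_def[symmetric] lhs D_eq[symmetric]
    unfolding s_def[symmetric] sg_def[symmetric] Z_def[symmetric] final
    by (simp only: of_real_mult mult_ac)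
qed

end
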